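(* Consider the system $$x_{k+1}=(A_kx_k+\bar A_kEx_k+B_ku_k+\bar B_kEu_k)+(C_kx_k+\bar C_kEx_k+D_ku_k+\bar D_kEu_k)w_k,\quad x_0=\xi,$$ and the cost $$J_N=\sum_{k=0}^NE\big[x_k'Q_kx_k+(Ex_k)'\bar Q_kEx_k+u_k'R_ku_k+(Eu_k)'\bar R_kEu_k\big]+E(x_{N+1}'P_{N+1}x_{N+1})+(Ex_{N+1})'\bar P_{N+1}Ex_{N+1}.$$ The necessary condition for minimizing $J_N$ for this system can be stated as $$0=E\left\{R_ku_k+\bar R_kEu_k+\begin{bmatrix}B_k+w_kD_k\\ 0\end{bmatrix}'\lambda_k+E\left\{\begin{bmatrix}\bar B_k+w_k\bar D_k\\ B_k+\bar B_k\end{bmatrix}'\lambda_k\right\}\Bigg|\mathcal F_{k-1}\right\},$$ where the costate $\lambda_k$ satisfies the iteration $$\lambda_{k-1}=E\left\{\begin{bmatrix}Q_kx_k+\bar Q_kEx_k\\ 0\end{bmatrix}+\begin{bmatrix}A_k+w_kC_k&\bar A_k+w_k\bar C_k\\ 0&A_k+\bar A_k\end{bmatrix}'\lambda_k\Bigg|\mathcal F_{k-1}\right\}$$ with final condition $$\lambda_N=\begin{bmatrix}P_{N+1}&\bar P_{N+1}^{(1)}\\ \bar P_{N+1}^{(2)}&\bar P_{N+1}^{(3)}\end{bmatrix}\begin{bmatrix}x_{N+1}\\ E x_{N+1}\end{bmatrix},\qquad \bar P_{N+1}^{(1)}=\bar P_{N+1},\quad \bar P_{N+1}^{(2)}=\bar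 P_{N+1}^{(3)}=0,$$ with $P_{N+1}$ and $\bar P_{N+1}$ the terminal weights in the cost.
   Context: $x_k\in\mathcal R^n$ is the state and $u_k\in\mathcal R^m$ the control. $A_k,\bar A_k,C_k,\bar C_k\in\mathcal R^{n\times n}$ and $B_k,\bar B_k,D_k,\bar D_k\in\mathcal R^{n\times m}$ are given deterministic matrices; $Q_k,\bar Q_k,R_k,\bar R_k,P_{N+1},\bar P_{N+1}$ are deterministic symmetric matrices of compatible dimensions. $(w_k)_{k=0}^N$ is scalar-valued random white noise with zero mean and variance $\sigma^2$; $E$ is the expectation over the noise and the initial state $\xi$. $\mathcal F_k$ is the natural filtration generated by $\xi,w_0,\dots,w_k$ augmented by all null sets, and $\mathcal F_{-1}$ is understood as $\{\emptyset,\Omega\}$. The minimization is over controls with $u_k$ $\mathcal F_{k-1}$-measurable and $E|u_k|^2<\infty$. A prime denotes transpose.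
   Formalization: White noise is read as an independent sequence, and the initial state ξ is assumed square integrable and independent of the noise; if ξ may depend on later noise (e.g. ξ = 1 + w_1), the stated necessary condition can fail. *)

theory Defs
  imports "HOL-Probability.Probability"
begin

text \<open>With \<open>'a = real\<close> this stacks vectors; with \<open>'a = real ^ 'c\<close> it stacks the rows of matrices.\<close>

definition vstack :: "'a ^ 'p \<Rightarrow> 'a ^ 'q \<Rightarrow> 'a ^ ('p + 'q)" where
  "vstack X Y = (\<chi> i. case i of Inl a \<Rightarrow> X $ a | Inr b \<Rightarrow> Y $ b)"

definition block_mat ::
  "real ^ 'c ^ 'p \<Rightarrow> real ^ 'd ^ 'p \<Rightarrow> real ^ 'c ^ 'q \<Rightarrow> real ^ 'd ^ 'q \<Rightarrow>
    real ^ ('c + 'd) ^ ('p + 'q)" where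
  "block_mat X Y Z W = vstack (\<chi> i. vstack (X $ i) (Y $ i)) (\<chi> i. vstack (Z $ i) (W $ i))"

text \<open>White noise is read as an independent (not necessarily identically distributed)
  sequence.\<close>

definition white_noise :: "'a measure \<Rightarrow> nat \<Rightarrow> real \<Rightarrow> (nat \<Rightarrow> 'a \<Rightarrow> real) \<Rightarrow> bool" where
  "white_noise M N \<sigma> w \<longleftrightarrow>
     prob_space.indep_vars M (\<lambda>_. borel) w {..N} \<and>
     (\<forall>k\<le>N. integrable M (\<lambda>\<omega>. (w k \<omega>)\<^sup>2) \<and>
            prob_space.expectation M (w k) = 0 \<and> prob_space.variance M (w k) = \<sigma>\<^sup>2)"

text \<open>The time index is an integer because the index \<open>-1\<close> occurs, with the trivial
  \<open>\<sigma>\<close>-algebra (so a non-constant \<open>\<xi>\<close> is not measurable at time \<open>-1\<close>).\<close>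

definition mf_filtration ::
  "'a measure \<Rightarrow> ('a \<Rightarrow> real ^ 'n) \<Rightarrow> (nat \<Rightarrow> 'a \<Rightarrow> real) \<Rightarrow> int \<Rightarrow> 'a measure" where
  "mf_filtration M \<xi> w k =
     (if k < 0 then sigma (space M) {}
      else sigma (space M)
        ({\<xi> -` S \<inter> space M | S. S \<in> sets borel} \<union>
         {w i -` S \<inter> space M | i S. int i \<le> k \<and> S \<in> sets borel} \<union>
         null_sets M))"

primrec mf_state ::
  "'a measure \<Rightarrow>
   (nat \<Rightarrow> real ^ 'n ^ 'n) \<Rightarrow> (nat \<Rightarrow> real ^ 'n ^ 'n) \<Rightarrow>
   (nat \<Rightarrow> real ^ 'm ^ 'n) \<Rightarrow> (nat \<Rightarrow> real ^ 'm ^ 'n) \<Rightarrow>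
   (nat \<Rightarrow> real ^ 'n ^ 'n) \<Rightarrow> (nat \<Rightarrow> real ^ 'n ^ 'n) \<Rightarrow>
   (nat \<Rightarrow> real ^ 'm ^ 'n) \<Rightarrow> (nat \<Rightarrow> real ^ 'm ^ 'n) \<Rightarrow>
   (nat \<Rightarrow> 'a \<Rightarrow> real) \<Rightarrow> ('a \<Rightarrow> real ^ 'n) \<Rightarrow> (nat \<Rightarrow> 'a \<Rightarrow> real ^ 'm) \<Rightarrow>
   nat \<Rightarrow> 'a \<Rightarrow> real ^ 'n" where
  "mf_state M A Abar B Bbar C Cbar D Dbar w \<xi> u 0 = \<xi>"
| "mf_state M A Abar B Bbar C Cbar D Dbar w \<xi> u (Suc k) =
     (let x = mf_state M A Abar B Bbar C Cbar D Dbar w \<xi> u k;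
          Ex = integral\<^sup>L M x;
          Eu = integral\<^sup>L M (u k)
      in (\<lambda>\<omega>. (A k *v x \<omega> + Abar k *v Ex + B k *v u k \<omega> + Bbar k *v Eu)
            + w k \<omega> *\<^sub>R (C k *v x \<omega> + Cbar k *v Ex + D k *v u k \<omega> + Dbar k *v Eu)))"

definition mf_cost ::
  "'a measure \<Rightarrow> nat \<Rightarrow>
   (nat \<Rightarrow> real ^ 'n ^ 'n) \<Rightarrow> (nat \<Rightarrow> real ^ 'n ^ 'n) \<Rightarrow>
   (nat \<Rightarrow> real ^ 'm ^ 'm) \<Rightarrow> (nat \<Rightarrow> real ^ 'm ^ 'm) \<Rightarrow>
   real ^ 'n ^ 'n \<Rightarrow> real ^ 'n ^ 'n \<Rightarrow>
   (nat \<Rightarrow> 'a \<Rightarrow> real ^ 'n) \<Rightarrow> (nat \<Rightarrow> 'a \<Rightarrow> real ^ 'm) \<Rightarrow> real" where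
  "mf_cost M N Q Qbar R Rbar P Pbar x u =
     (\<Sum>k\<le>N. \<integral>\<omega>. (x k \<omega> \<bullet> (Q k *v x k \<omega>)
                  + integral\<^sup>L M (x k) \<bullet> (Qbar k *v integral\<^sup>L M (x k))
                  + u k \<omega> \<bullet> (R k *v u k \<omega>)
                  + integral\<^sup>L M (u k) \<bullet> (Rbar k *v integral\<^sup>L M (u k))) \<partial>M)
     + (\<integral>\<omega>. x (Suc N) \<omega> \<bullet> (P *v x (Suc N) \<omega>) \<partial>M)
     + integral\<^sup>L M (x (Suc N)) \<bullet> (Pbar *v integral\<^sup>L M (x (Suc N)))"

definition mf_admissible ::
  "'a measure \<Rightarrow> (int \<Rightarrow> 'a measure) \<Rightarrow> nat \<Rightarrow> (nat \<Rightarrow> 'a \<Rightarrow> real ^ 'm) \<Rightarrow> bool" where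
  "mf_admissible M F N u \<longleftrightarrow>
     (\<forall>k\<le>N. u k \<in> borel_measurable (F (int k - 1)) \<and>
            integrable M (\<lambda>\<omega>. (norm (u k \<omega>))\<^sup>2))"

text \<open>\<open>g\<close> is a version of \<open>E[f | F]\<close>.  Integrability of \<open>f\<close> is demanded because
  \<^const>\<open>real_cond_exp\<close> is a total function, meaningless on non-integrable arguments.\<close>

definition is_cond_exp ::
  "'a measure \<Rightarrow> 'a measure \<Rightarrow> ('a \<Rightarrow> real ^ 'd) \<Rightarrow> ('a \<Rightarrow> real ^ 'd) \<Rightarrow> bool" where
  "is_cond_exp M F f g \<longleftrightarrow>
     integrable M f \<and> g \<in> borel_measurable F \<and>
     (AE \<omega> in M. g \<omega> = (\<chi> i. real_cond_exp M F (\<lambda>\<omega>. f \<omega> $ i) \<omega>))"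

definition mf_costate ::
  "'a measure \<Rightarrow> (int \<Rightarrow> 'a measure) \<Rightarrow> nat \<Rightarrow>
   (nat \<Rightarrow> real ^ 'n ^ 'n) \<Rightarrow> (nat \<Rightarrow> real ^ 'n ^ 'n) \<Rightarrow>
   (nat \<Rightarrow> real ^ 'n ^ 'n) \<Rightarrow> (nat \<Rightarrow> real ^ 'n ^ 'n) \<Rightarrow>
   (nat \<Rightarrow> real ^ 'n ^ 'n) \<Rightarrow> (nat \<Rightarrow> real ^ 'n ^ 'n) \<Rightarrow>
   real ^ 'n ^ 'n \<Rightarrow> real ^ 'n ^ 'n \<Rightarrow>
   (nat \<Rightarrow> 'a \<Rightarrow> real) \<Rightarrow> (nat \<Rightarrow> 'a \<Rightarrow> real ^ 'n) \<Rightarrow>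
   (int \<Rightarrow> 'a \<Rightarrow> real ^ ('n + 'n)) \<Rightarrow> bool" where
  "mf_costate M F N A Abar C Cbar Q Qbar P Pbar w x l \<longleftrightarrow>
     l (int N) \<in> borel_measurable (F (int N)) \<and>
     (AE \<omega> in M. l (int N) \<omega> =
        block_mat P Pbar 0 0 *v vstack (x (Suc N) \<omega>) (integral\<^sup>L M (x (Suc N)))) \<and>
     (\<forall>k\<le>N. is_cond_exp M (F (int k - 1))
        (\<lambda>\<omega>. vstack (Q k *v x k \<omega> + Qbar k *v integral\<^sup>L M (x k)) 0
           + transpose (block_mat (A k + w k \<omega> *\<^sub>R C k) (Abar k + w k \<omega> *\<^sub>R Cbar k)
                                  0                     (A k + Abar k)) *v l (int k) \<omega>)
        (l (int k - 1)))"

end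

theory Submission
  imports Defs
begin

text \<open>Perturbing the optimal control \<open>u\<close> to \<open>u + t v\<close> perturbs the state to \<open>x + t y\<close>, where \<open>y\<close> solves
  the same dynamics from \<open>0\<close> with control \<open>v\<close>, so the cost is a quadratic polynomial in \<open>t\<close> whose
  linear coefficient must vanish.  Stacking \<open>y\<close> with its mean gives an ordinary linear recursion whose
  adjoint is the costate equation; telescoping \<open>E[\<lambda>' (y, Ey)]\<close> along it rewrites the linear coefficient as
  \<open>\<Sum>k. E[g k' v k]\<close>, with \<open>g k\<close> the random vector whose conditional expectation is claimed to vanish.
  Controls \<open>v\<close> that are a multiple of an indicator at a single time then yield the claim.  All pairings are
  integrable because the costate is square integrable and the noise \<open>w k\<close> is independent of the past.\<close>

section \<open>Block vectors and matrices\<close>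

lemma vstack_nth [simp]:
  "vstack X Y $ Inl i = X $ i" "vstack X Y $ Inr j = Y $ j"
  by (simp_all add: vstack_def)

lemma sum_UNIV_sum_type:
  fixes g :: "'a::finite + 'b::finite \<Rightarrow> 'c::comm_monoid_add"
  shows "sum g UNIV = (\<Sum>i\<in>UNIV. g (Inl i)) + (\<Sum>j\<in>UNIV. g (Inr j))"
  unfolding UNIV_Plus_UNIV[symmetric] by (subst sum.Plus) auto

lemma inner_vstack:
  fixes a c :: "real ^ 'p::finite" and b d :: "real ^ 'q::finite"
  shows "vstack a b \<bullet> vstack c d = a \<bullet> c + b \<bullet> d"
  by (simp add: inner_vec_def sum_UNIV_sum_type)

lemma vstack_mult_vec:
  fixes X :: "real ^ 'c ^ 'p" and Y :: "real ^ 'c ^ 'q"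
  shows "vstack X Y *v z = vstack (X *v z) (Y *v z)"
  by (simp add: vec_eq_iff split_sum_all matrix_vector_mult_def)

lemma block_mat_mult_vec:
  "block_mat X Y Z W *v vstack a b = vstack (X *v a + Y *v b) (Z *v a + W *v b)"
  by (simp add: vec_eq_iff split_sum_all matrix_vector_mult_def block_mat_def sum_UNIV_sum_type)

lemma inner_transpose_left:
  fixes T :: "real ^ 'n ^ 'm"
  shows "(transpose T *v y) \<bullet> x = y \<bullet> (T *v x)"
  by (simp add: dot_lmul_matrix)

lemma block_mat_affine:
  "block_mat (X + s *\<^sub>R X') (Y + s *\<^sub>R Y') 0 Z = block_mat X Y 0 Z + s *\<^sub>R block_mat X' Y' 0 0"
  by (simp add: vec_eq_iff split_sum_all block_mat_def)

lemma vstack_affine: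
  fixes X X' :: "real ^ 'c ^ 'p" and Y :: "real ^ 'c ^ 'q"
  shows "vstack (X + s *\<^sub>R X') Y = vstack X Y + s *\<^sub>R vstack X' 0"
  by (simp add: vec_eq_iff split_sum_all)

lemma transpose_affine_mult_vec:
  fixes S T :: "real ^ 'n ^ 'm"
  shows "transpose (S + s *\<^sub>R T) *v y = transpose S *v y + s *\<^sub>R (transpose T *v y)"
proof -
  have "transpose (S + s *\<^sub>R T) = transpose S + s *\<^sub>R transpose T"
    by (simp add: transpose_def vec_eq_iff)
  then show ?thesis
    by (simp only: matrix_vector_mult_add_rdistrib scaleR_matrix_vector_assoc)
qed

lemma linear_vstack:
  "linear (\<lambda>a :: real ^ 'p. vstack a (0 :: real ^ 'q))"
  "linear (\<lambda>b :: real ^ 'q. vstack (0 :: real ^ 'p) b)"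
  by (auto intro!: linearI simp: vec_eq_iff split_sum_all)

lemma vstack_eq_add:
  fixes a :: "real ^ 'p" and b :: "real ^ 'q"
  shows "vstack a b = vstack a 0 + vstack 0 b"
  by (simp add: vec_eq_iff split_sum_all)

lemma measurable_linear_image:
  fixes T :: "'b::euclidean_space \<Rightarrow> 'c::euclidean_space"
  assumes "linear T" "f \<in> borel_measurable S"
  shows "(\<lambda>\<omega>. T (f \<omega>)) \<in> borel_measurable S"
  by (intro measurable_compose[OF assms(2)] borel_measurable_continuous_onI
      linear_continuous_on) (use assms in \<open>simp add: linear_conv_bounded_linear\<close>)

lemma measurable_mult_vec [measurable]:
  fixes T :: "real ^ 'n ^ 'm"
  assumes "f \<in> borel_measurable S"
  shows "(\<lambda>\<omega>. T *v f \<omega>) \<in> borel_measurable S"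
  by (rule measurable_linear_image[OF matrix_vector_mul_linear assms])

lemma measurable_vstack [measurable]:
  fixes f :: "'a \<Rightarrow> real ^ 'p" and g :: "'a \<Rightarrow> real ^ 'q"
  assumes "f \<in> borel_measurable S" "g \<in> borel_measurable S"
  shows "(\<lambda>\<omega>. vstack (f \<omega>) (g \<omega>)) \<in> borel_measurable S"
  unfolding vstack_eq_add[of "f _" "g _"]
  by (intro borel_measurable_add measurable_linear_image[OF linear_vstack(1)]
      measurable_linear_image[OF linear_vstack(2)] assms)

lemma measurable_vec_nth [measurable (raw)]:
  fixes f :: "'a \<Rightarrow> real ^ 'p"
  assumes "f \<in> borel_measurable S"
  shows "(\<lambda>\<omega>. f \<omega> $ i) \<in> borel_measurable S"
  by (rule measurable_linear_image[OF _ assms]) (simp add: linear_conv_bounded_linear bounded_linear_vec_nth)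

lemma measurable_vec_lambda:
  fixes f :: "'p::finite \<Rightarrow> 'a \<Rightarrow> real"
  assumes "\<And>i. f i \<in> borel_measurable S"
  shows "(\<lambda>\<omega>. \<chi> i. f i \<omega>) \<in> borel_measurable S"
proof -
  have "(\<lambda>\<omega>. \<chi> i. f i \<omega>) = (\<lambda>\<omega>. \<Sum>i\<in>UNIV. f i \<omega> *\<^sub>R axis i 1)"
    by (subst basis_expansion[symmetric]) (simp add: scalar_mult_eq_scaleR)
  then show ?thesis
    using assms by (simp add: borel_measurable_sum borel_measurable_scaleR)
qed

lemma integrable_mult_vec:
  fixes T :: "real ^ 'n ^ 'm"
  assumes "integrable S f"
  shows "integrable S (\<lambda>\<omega>. T *v f \<omega>)"
  using integrable_bounded_linear[OF matrix_vector_mul_bounded_linear[of T] assms] .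

lemma integral_mult_vec:
  fixes T :: "real ^ 'n ^ 'm"
  assumes "integrable S f"
  shows "(\<integral>\<omega>. T *v f \<omega> \<partial>S) = T *v integral\<^sup>L S f"
  using integral_bounded_linear[OF matrix_vector_mul_bounded_linear[of T] assms] .

lemma integrable_vec_nth:
  fixes f :: "'a \<Rightarrow> real ^ 'p"
  assumes "integrable S f"
  shows "integrable S (\<lambda>\<omega>. f \<omega> $ i)"
  using integrable_bounded_linear[OF bounded_linear_vec_nth assms] .

lemma integral_vec_nth:
  fixes f :: "'a \<Rightarrow> real ^ 'p"
  assumes "integrable S f"
  shows "(\<integral>\<omega>. f \<omega> $ i \<partial>S) = integral\<^sup>L S f $ i"
  using integral_bounded_linear[OF bounded_linear_vec_nth assms] .

section \<open>Square integrable functions\<close>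

definition square_integrable :: "'a measure \<Rightarrow> ('a \<Rightarrow> 'b::euclidean_space) \<Rightarrow> bool" where
  "square_integrable M f \<longleftrightarrow> f \<in> borel_measurable M \<and> integrable M (\<lambda>\<omega>. (norm (f \<omega>))\<^sup>2)"

lemma square_integrable_measurable [measurable_dest]:
  "square_integrable M f \<Longrightarrow> f \<in> borel_measurable M"
  by (simp add: square_integrable_def)

lemma square_integrable_bound:
  assumes "square_integrable M g" "f \<in> borel_measurable M"
    and "\<And>\<omega>. norm (f \<omega>) \<le> K * norm (g \<omega>)"
  shows "square_integrable M f"
  unfolding square_integrable_def
proof
  have "(norm (f \<omega>))\<^sup>2 \<le> K\<^sup>2 * (norm (g \<omega>))\<^sup>2" for \<omega>
    using power_mono[OF assms(3)[of \<omega>], of 2] by (simp add: power_mult_distrib)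
  moreover have "integrable M (\<lambda>\<omega>. K\<^sup>2 * (norm (g \<omega>))\<^sup>2)"
    using assms(1) by (simp add: square_integrable_def)
  ultimately show "integrable M (\<lambda>\<omega>. (norm (f \<omega>))\<^sup>2)"
    using assms(2) by (elim Bochner_Integration.integrable_bound) auto
qed (rule assms)

lemma square_integrable_linear:
  fixes T :: "'b::euclidean_space \<Rightarrow> 'c::euclidean_space"
  assumes "linear T" "square_integrable M f"
  shows "square_integrable M (\<lambda>\<omega>. T (f \<omega>))"
proof -
  obtain K where K: "\<forall>x. norm (T x) \<le> K * norm x"
    using linear_bounded[OF assms(1)] by (elim exE)
  have "f \<in> borel_measurable M"
    using assms(2) by (simp add: square_integrable_def)
  then show ?thesis
    using K by (intro square_integrable_bound[OF assms(2), where K = K]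
        measurable_linear_image[OF assms(1)]) simp_all
qed

lemma square_integrable_scaleR:
  "square_integrable M f \<Longrightarrow> square_integrable M (\<lambda>\<omega>. c *\<^sub>R f \<omega>)"
  by (rule square_integrable_linear) (simp_all add: linear_scale_self)

lemma square_integrable_add:
  assumes "square_integrable M f" "square_integrable M g"
  shows "square_integrable M (\<lambda>\<omega>. f \<omega> + g \<omega>)"
proof -
  have [measurable]: "f \<in> borel_measurable M" "g \<in> borel_measurable M"
    using assms by (auto simp: square_integrable_def)
  have "(norm (f \<omega> + g \<omega>))\<^sup>2 \<le> 2 * (norm (f \<omega>))\<^sup>2 + 2 * (norm (g \<omega>))\<^sup>2" for \<omega>
  proof -
    have "(norm (f \<omega> + g \<omega>))\<^sup>2 \<le> (norm (f \<omega>) + norm (g \<omega>))\<^sup>2"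
      by (intro power_mono norm_triangle_ineq) simp
    then show ?thesis
      using sum_squares_bound[of "norm (f \<omega>)" "norm (g \<omega>)"] by (simp add: power2_sum)
  qed
  moreover have "integrable M (\<lambda>\<omega>. 2 * (norm (f \<omega>))\<^sup>2 + 2 * (norm (g \<omega>))\<^sup>2)"
    using assms by (simp add: square_integrable_def)
  ultimately have "integrable M (\<lambda>\<omega>. (norm (f \<omega> + g \<omega>))\<^sup>2)"
    by (elim Bochner_Integration.integrable_bound) auto
  then show ?thesis by (simp add: square_integrable_def)
qed

lemma square_integrable_mult_vec:
  fixes T :: "real ^ 'n ^ 'm"
  assumes "square_integrable M f"
  shows "square_integrable M (\<lambda>\<omega>. T *v f \<omega>)"
  by (rule square_integrable_linear[OF matrix_vector_mul_linear assms])

lemma square_integrable_vstack: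
  fixes f :: "'a \<Rightarrow> real ^ 'p" and g :: "'a \<Rightarrow> real ^ 'q"
  assumes "square_integrable M f" "square_integrable M g"
  shows "square_integrable M (\<lambda>\<omega>. vstack (f \<omega>) (g \<omega>))"
  unfolding vstack_eq_add[of "f _" "g _"]
  by (intro square_integrable_add assms square_integrable_linear[OF linear_vstack(1)]
      square_integrable_linear[OF linear_vstack(2)])

lemma square_integrable_vec_nth:
  fixes f :: "'a \<Rightarrow> real ^ 'p"
  assumes "square_integrable M f"
  shows "square_integrable M (\<lambda>\<omega>. f \<omega> $ i)"
  by (rule square_integrable_linear[OF _ assms]) (simp add: linear_conv_bounded_linear bounded_linear_vec_nth)

lemma square_integrable_vecI:
  fixes f :: "'a \<Rightarrow> real ^ 'p"
  assumes "\<And>i. square_integrable M (\<lambda>\<omega>. f \<omega> $ i)"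
  shows "square_integrable M f"
proof -
  have "f \<omega> = (\<chi> i. f \<omega> $ i)" for \<omega> by simp
  moreover have "(\<lambda>\<omega>. \<chi> i. f \<omega> $ i) \<in> borel_measurable M"
    using assms by (intro measurable_vec_lambda) (auto simp: square_integrable_def)
  ultimately have "f \<in> borel_measurable M" by simp
  moreover have "(norm (f \<omega>))\<^sup>2 = (\<Sum>i\<in>UNIV. (norm (f \<omega> $ i))\<^sup>2)" for \<omega>
    by (simp add: norm_vec_def L2_set_def sum_nonneg)
  ultimately show ?thesis
    using assms by (simp add: square_integrable_def)
qed

lemma square_integrable_cong_AE:
  assumes "square_integrable M f" "g \<in> borel_measurable M" "AE \<omega> in M. g \<omega> = f \<omega>"
  shows "square_integrable M g"
proof -
  have "integrable M (\<lambda>\<omega>. (norm (g \<omega>))\<^sup>2) \<longleftrightarrow> integrable M (\<lambda>\<omega>. (norm (f \<omega>))\<^sup>2)"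
    using assms by (intro integrable_cong_AE) (auto simp: square_integrable_def)
  then show ?thesis using assms by (simp add: square_integrable_def)
qed

lemma square_integrable_inner:
  assumes "square_integrable M f" "square_integrable M g"
  shows "integrable M (\<lambda>\<omega>. f \<omega> \<bullet> g \<omega>)"
proof -
  have [measurable]: "f \<in> borel_measurable M" "g \<in> borel_measurable M"
    using assms by (auto simp: square_integrable_def)
  have "norm (f \<omega> \<bullet> g \<omega>) \<le> (norm (f \<omega>))\<^sup>2 + (norm (g \<omega>))\<^sup>2" for \<omega>
    using Cauchy_Schwarz_ineq2[of "f \<omega>" "g \<omega>"] sum_squares_bound[of "norm (f \<omega>)" "norm (g \<omega>)"]
    by simp
  moreover have "integrable M (\<lambda>\<omega>. (norm (f \<omega>))\<^sup>2 + (norm (g \<omega>))\<^sup>2)"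
    using assms by (simp add: square_integrable_def)
  ultimately show ?thesis
    by (elim Bochner_Integration.integrable_bound) (auto intro: order_trans[OF _ abs_ge_self])
qed

lemma square_integrable_scaleR_mult:
  fixes f :: "'a \<Rightarrow> real" and g :: "'a \<Rightarrow> 'b::euclidean_space"
  assumes "square_integrable M f" "square_integrable M g"
  shows "integrable M (\<lambda>\<omega>. f \<omega> *\<^sub>R g \<omega>)"
proof -
  have [measurable]: "f \<in> borel_measurable M" "g \<in> borel_measurable M"
    using assms by (auto simp: square_integrable_def)
  have "norm (f \<omega> *\<^sub>R g \<omega>) \<le> (norm (f \<omega>))\<^sup>2 + (norm (g \<omega>))\<^sup>2" for \<omega>
    using sum_squares_bound[of "norm (f \<omega>)" "norm (g \<omega>)"]
      mult_nonneg_nonneg[OF norm_ge_zero[of "f \<omega>"] norm_ge_zero[of "g \<omega>"]]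
    unfolding norm_scaleR real_norm_def by linarith
  moreover have "integrable M (\<lambda>\<omega>. (norm (f \<omega>))\<^sup>2 + (norm (g \<omega>))\<^sup>2)"
    using assms by (simp add: square_integrable_def)
  ultimately show ?thesis
    by (elim Bochner_Integration.integrable_bound) (auto intro: order_trans[OF _ abs_ge_self])
qed

lemma (in finite_measure) square_integrable_const [simp]: "square_integrable M (\<lambda>_. c)"
  by (simp add: square_integrable_def)

lemma (in finite_measure) square_integrable_integrable:
  assumes "square_integrable M f"
  shows "integrable M f"
  using square_integrable_scaleR_mult[OF square_integrable_const[of 1] assms] by simp

section \<open>Conditional expectations under independent noise\<close>

locale white_step = prob_space M for M :: "'a measure" +
  fixes H :: "'a measure" and w :: "'a \<Rightarrow> real" and s :: real
  assumes subalg: "subalgebra M H"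
    and noise_measurable [measurable]: "w \<in> borel_measurable M"
    and noise_indep: "indep_set (sigma_sets (space M) {w -` S \<inter> space M |S. S \<in> sets borel}) (sets H)"
    and noise_square: "integrable M (\<lambda>\<omega>. (w \<omega>)\<^sup>2)"
    and noise_mean: "(\<integral>\<omega>. w \<omega> \<partial>M) = 0"
    and noise_variance: "(\<integral>\<omega>. (w \<omega>)\<^sup>2 \<partial>M) = s"
begin

lemma noise_square_integrable: "square_integrable M w"
  using noise_square by (simp add: square_integrable_def)

lemma measurable_H: "f \<in> measurable H S \<Longrightarrow> f \<in> measurable M S"
  by (rule measurable_from_subalg[OF subalg])

lemma indep_var_noise:
  assumes "X \<in> borel_measurable H"
  shows "indep_var borel w borel X"
  unfolding indep_var_eq
proof (intro conjI)
  have "sigma_sets (space M) {X -` A \<inter> space M |A. A \<in> sets borel} \<subseteq> sets H"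
    using assms subalg measurable_sets[OF assms]
    by (subst (2) sets.sigma_sets_eq[symmetric]) (auto intro!: sigma_sets_mono' simp: subalgebra_def)
  then show "indep_set (sigma_sets (space M) {w -` A \<inter> space M |A. A \<in> sets borel})
      (sigma_sets (space M) {X -` A \<inter> space M |A. A \<in> sets borel})"
    using noise_indep unfolding indep_set_def
    by (elim indep_sets_mono_sets) (auto split: bool.split)
qed (use assms measurable_H in auto)

lemma noise_times_square_integrable:
  fixes f :: "'a \<Rightarrow> 'b::euclidean_space"
  assumes "square_integrable M f" "f \<in> borel_measurable H"
  shows "square_integrable M (\<lambda>\<omega>. w \<omega> *\<^sub>R f \<omega>)"
    and "(\<integral>\<omega>. (norm (w \<omega> *\<^sub>R f \<omega>))\<^sup>2 \<partial>M) = s * (\<integral>\<omega>. (norm (f \<omega>))\<^sup>2 \<partial>M)"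
proof -
  have f: "integrable M (\<lambda>\<omega>. (norm (f \<omega>))\<^sup>2)"
    using assms(1) by (simp add: square_integrable_def)
  have [measurable]: "f \<in> borel_measurable M"
    using assms(1) by (simp add: square_integrable_def)
  have "(\<lambda>\<omega>. norm (f \<omega>)) \<in> borel_measurable H"
    using assms(2) by measurable
  from indep_var_compose[OF indep_var_noise[OF this], of power2 borel power2 borel]
  have iv: "indep_var borel (\<lambda>\<omega>. (w \<omega>)\<^sup>2) borel (\<lambda>\<omega>. (norm (f \<omega>))\<^sup>2)"
    by (simp add: comp_def)
  show "square_integrable M (\<lambda>\<omega>. w \<omega> *\<^sub>R f \<omega>)"
    using indep_var_integrable[OF iv noise_square f]
    by (simp add: square_integrable_def power_mult_distrib)
  show "(\<integral>\<omega>. (norm (w \<omega> *\<^sub>R f \<omega>))\<^sup>2 \<partial>M) = s * (\<integral>\<omega>. (norm (f \<omega>))\<^sup>2 \<partial>M)"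
    using indep_var_lebesgue_integral[OF iv noise_square f] noise_variance
    by (simp add: power_mult_distrib)
qed

lemma integral_noise_times:
  fixes f :: "'a \<Rightarrow> real ^ 'p"
  assumes "square_integrable M f" "f \<in> borel_measurable H"
  shows "(\<integral>\<omega>. w \<omega> *\<^sub>R f \<omega> \<partial>M) = 0"
proof -
  have int: "integrable M (\<lambda>\<omega>. w \<omega> *\<^sub>R f \<omega>)"
    by (intro square_integrable_integrable noise_times_square_integrable assms)
  have "(\<integral>\<omega>. w \<omega> *\<^sub>R f \<omega> \<partial>M) $ i = 0" for i
  proof -
    have "(\<lambda>\<omega>. f \<omega> $ i) \<in> borel_measurable H"
      using assms(2) by measurable
    from indep_var_lebesgue_integral[OF indep_var_noise[OF this]]
    have "(\<integral>\<omega>. w \<omega> * f \<omega> $ i \<partial>M) = 0"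
      using noise_mean assms(1) noise_square_integrable
      by (simp add: square_integrable_integrable square_integrable_vec_nth)
    then show ?thesis
      using integral_vec_nth[OF int, of i] by simp
  qed
  then show ?thesis by (simp add: vec_eq_iff)
qed

lemma integrable_affine_noise:
  fixes a b :: "'a \<Rightarrow> 'b::euclidean_space"
  assumes "square_integrable M a" "square_integrable M b"
  shows "integrable M (\<lambda>\<omega>. a \<omega> + w \<omega> *\<^sub>R b \<omega>)"
  by (intro Bochner_Integration.integrable_add square_integrable_integrable
      square_integrable_scaleR_mult noise_square_integrable assms)

end

locale white_step_conditional = white_step +
  fixes G :: "'a measure"
  assumes subalg_G: "subalgebra H G"
begin

lemma subalg_MG: "subalgebra M G"
  using subalg subalg_G by (auto simp: subalgebra_def)

sublocale finite_measure_subalgebra M G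
  by unfold_locales (rule subalg_MG)

lemma measurable_GH: "f \<in> measurable G S \<Longrightarrow> f \<in> measurable H S"
  by (rule measurable_from_subalg[OF subalg_G])

lemma measurable_GM: "f \<in> measurable G S \<Longrightarrow> f \<in> measurable M S"
  by (intro measurable_H measurable_GH)

text \<open>The product of the noise with a square integrable function need not be square integrable,
  but testing the conditional expectation \<open>g\<close> against its own truncations moves
  the noise onto a \<open>G\<close>-measurable factor, from which it is independent; AM-GM then
  bounds the truncated second moments of \<open>g\<close> uniformly.\<close>

lemma square_integrable_real_cond_exp:
  fixes a b :: "'a \<Rightarrow> real"
  assumes a: "square_integrable M a" and b: "square_integrable M b"
  defines "f \<equiv> \<lambda>\<omega>. a \<omega> + w \<omega> * b \<omega>"
  shows "square_integrable M (real_cond_exp M G f)"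
proof -
  define g where "g = real_cond_exp M G f"
  have [measurable]: "a \<in> borel_measurable M" "b \<in> borel_measurable M"
    using a b by (auto simp: square_integrable_def)
  have gG [measurable]: "g \<in> borel_measurable G" and gM [measurable]: "g \<in> borel_measurable M"
    by (simp_all add: g_def)
  have f_int: "integrable M f"
    using integrable_affine_noise[OF a b] by (simp add: f_def)
  have fM [measurable]: "f \<in> borel_measurable M"
    by (simp add: f_def)
  have s_nonneg: "0 \<le> s"
    using noise_variance Bochner_Integration.integral_nonneg[of M "\<lambda>\<omega>. (w \<omega>)\<^sup>2"] by simp
  define c where "c = s + 1"
  define K where "K = 2 * ((\<integral>\<omega>. (a \<omega>)\<^sup>2 \<partial>M) + c * (\<integral>\<omega>. (b \<omega>)\<^sup>2 \<partial>M))"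
  define h where "h = (\<lambda>n \<omega>. if \<bar>g \<omega>\<bar> \<le> real n then g \<omega> else 0)"
  have hG [measurable]: "h n \<in> borel_measurable G" for n
    unfolding h_def by measurable
  have hM [measurable]: "h n \<in> borel_measurable M" for n
    unfolding h_def by measurable
  have h_bdd: "\<bar>h n \<omega>\<bar> \<le> real n" for n \<omega>
    by (simp add: h_def)
  have h_sq: "square_integrable M (h n)" for n
    by (rule square_integrable_bound[OF square_integrable_const[of "1::real"], where K = "real n"])
      (use h_bdd in auto)
  have bound: "(\<integral>\<omega>. (h n \<omega>)\<^sup>2 \<partial>M) \<le> K" for n
  proof -
    note wh = noise_times_square_integrable[OF h_sq[of n] measurable_GH[OF hG[of n]]]
    have hf: "integrable M (\<lambda>\<omega>. h n \<omega> * f \<omega>)"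
    proof (rule Bochner_Integration.integrable_bound)
      show "integrable M (\<lambda>\<omega>. real n * f \<omega>)" using f_int by simp
      show "AE \<omega> in M. norm (h n \<omega> * f \<omega>) \<le> norm (real n * f \<omega>)"
        using h_bdd by (auto simp: abs_mult intro!: mult_right_mono)
    qed simp
    have "h n \<omega> * g \<omega> = (h n \<omega>)\<^sup>2" for \<omega>
      by (simp add: h_def power2_eq_square)
    then have "(\<integral>\<omega>. (h n \<omega>)\<^sup>2 \<partial>M) = (\<integral>\<omega>. h n \<omega> * f \<omega> \<partial>M)"
      using real_cond_exp_intg(2)[OF hf hG fM] by (simp add: g_def)
    also have "\<dots> \<le> (\<integral>\<omega>. (a \<omega>)\<^sup>2 + (h n \<omega>)\<^sup>2 / 4 + c * (b \<omega>)\<^sup>2 + (w \<omega> * h n \<omega>)\<^sup>2 / (4 * c) \<partial>M)"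
    proof (rule integral_mono[OF hf])
      show "integrable M (\<lambda>\<omega>. (a \<omega>)\<^sup>2 + (h n \<omega>)\<^sup>2 / 4 + c * (b \<omega>)\<^sup>2 + (w \<omega> * h n \<omega>)\<^sup>2 / (4 * c))"
        using a b h_sq[of n] wh(1) by (simp add: square_integrable_def)
      fix \<omega>
      have 1: "h n \<omega> * a \<omega> \<le> (a \<omega>)\<^sup>2 + (h n \<omega>)\<^sup>2 / 4"
        using zero_le_power2[of "a \<omega> - h n \<omega> / 2"] by (simp add: power2_diff power_divide algebra_simps)
      have "0 \<le> (2 * c * b \<omega> - w \<omega> * h n \<omega>)\<^sup>2 / (4 * c)"
        using s_nonneg by (simp add: c_def)
      also have "\<dots> = c * (b \<omega>)\<^sup>2 + (w \<omega> * h n \<omega>)\<^sup>2 / (4 * c) - h n \<omega> * (w \<omega> * b \<omega>)"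
        using s_nonneg by (simp add: c_def field_simps power2_eq_square)
      finally show "h n \<omega> * f \<omega> \<le> (a \<omega>)\<^sup>2 + (h n \<omega>)\<^sup>2 / 4 + c * (b \<omega>)\<^sup>2 + (w \<omega> * h n \<omega>)\<^sup>2 / (4 * c)"
        using 1 by (simp add: f_def algebra_simps)
    qed
    also have "\<dots> = (\<integral>\<omega>. (a \<omega>)\<^sup>2 \<partial>M) + (\<integral>\<omega>. (h n \<omega>)\<^sup>2 \<partial>M) / 4 + c * (\<integral>\<omega>. (b \<omega>)\<^sup>2 \<partial>M)
        + s * (\<integral>\<omega>. (h n \<omega>)\<^sup>2 \<partial>M) / (4 * c)"
      using a b h_sq[of n] wh by (simp add: square_integrable_def)
    also have "\<dots> \<le> (\<integral>\<omega>. (a \<omega>)\<^sup>2 \<partial>M) + (\<integral>\<omega>. (h n \<omega>)\<^sup>2 \<partial>M) / 4 + c * (\<integral>\<omega>. (b \<omega>)\<^sup>2 \<partial>M)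
        + (\<integral>\<omega>. (h n \<omega>)\<^sup>2 \<partial>M) / 4"
    proof -
      have "0 \<le> (\<integral>\<omega>. (h n \<omega>)\<^sup>2 \<partial>M)" by simp
      then have "s * (\<integral>\<omega>. (h n \<omega>)\<^sup>2 \<partial>M) / (4 * c) \<le> (\<integral>\<omega>. (h n \<omega>)\<^sup>2 \<partial>M) / 4"
        using s_nonneg by (simp add: c_def field_simps)
      then show ?thesis by (rule add_left_mono)
    qed
    finally show ?thesis unfolding K_def by argo
  qed
  have mono: "mono (\<lambda>n. (h n \<omega>)\<^sup>2)" for \<omega>
    by (auto simp: mono_def h_def)
  have "incseq (\<lambda>n. \<integral>\<omega>. (h n \<omega>)\<^sup>2 \<partial>M)"
    unfolding incseq_def
    using h_sq mono by (auto intro!: integral_mono simp: square_integrable_def dest: monoD)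
  then obtain L where L: "(\<lambda>n. \<integral>\<omega>. (h n \<omega>)\<^sup>2 \<partial>M) \<longlonglongrightarrow> L"
    using bound incseq_convergent[of _ K] by blast
  have "integrable M (\<lambda>\<omega>. (g \<omega>)\<^sup>2)"
  proof (rule integrable_monotone_convergence[OF _ _ _ L])
    show "AE \<omega> in M. (\<lambda>n. (h n \<omega>)\<^sup>2) \<longlonglongrightarrow> (g \<omega>)\<^sup>2"
    proof (intro AE_I2 tendsto_eventually)
      fix \<omega>
      show "\<forall>\<^sub>F n in sequentially. (h n \<omega>)\<^sup>2 = (g \<omega>)\<^sup>2"
        using eventually_ge_at_top[of "nat \<lceil>\<bar>g \<omega>\<bar>\<rceil>"]
        by eventually_elim (simp add: h_def nat_le_iff ceiling_le_iff)
    qed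
  qed (use h_sq mono in \<open>auto simp: square_integrable_def\<close>)
  then show ?thesis by (simp add: square_integrable_def flip: g_def)
qed

lemma is_cond_exp_exists:
  fixes f :: "'a \<Rightarrow> real ^ 'd"
  assumes "integrable M f"
  shows "is_cond_exp M G f (\<lambda>\<omega>. \<chi> i. real_cond_exp M G (\<lambda>\<omega>. f \<omega> $ i) \<omega>)"
  using assms by (auto simp: is_cond_exp_def intro!: measurable_vec_lambda)

lemma square_integrable_is_cond_exp:
  fixes a b g :: "'a \<Rightarrow> real ^ 'd"
  assumes "square_integrable M a" "square_integrable M b"
    and g: "is_cond_exp M G (\<lambda>\<omega>. a \<omega> + w \<omega> *\<^sub>R b \<omega>) g"
  shows "square_integrable M g"
proof (rule square_integrable_cong_AE)
  show "square_integrable M (\<lambda>\<omega>. \<chi> i. real_cond_exp M G (\<lambda>\<omega>. a \<omega> $ i + w \<omega> * b \<omega> $ i) \<omega>)"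
    by (rule square_integrable_vecI)
      (simp add: square_integrable_real_cond_exp square_integrable_vec_nth assms)
  show "g \<in> borel_measurable M"
    using g by (auto simp: is_cond_exp_def intro: measurable_GM)
  show "AE \<omega> in M. g \<omega> = (\<chi> i. real_cond_exp M G (\<lambda>\<omega>. a \<omega> $ i + w \<omega> * b \<omega> $ i) \<omega>)"
    using g by (simp add: is_cond_exp_def)
qed

lemma integrable_affine_noise_inner:
  fixes a b h :: "'a \<Rightarrow> 'b::euclidean_space"
  assumes "square_integrable M a" "square_integrable M b"
    and h: "square_integrable M h" "h \<in> borel_measurable G"
  shows "integrable M (\<lambda>\<omega>. (a \<omega> + w \<omega> *\<^sub>R b \<omega>) \<bullet> h \<omega>)"
proof -
  have "integrable M (\<lambda>\<omega>. a \<omega> \<bullet> h \<omega> + b \<omega> \<bullet> (w \<omega> *\<^sub>R h \<omega>))"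
    by (intro Bochner_Integration.integrable_add square_integrable_inner assms
        noise_times_square_integrable measurable_GH)
  then show ?thesis
    by (simp add: inner_add_left)
qed

lemma integral_is_cond_exp_inner:
  fixes a b g h :: "'a \<Rightarrow> real ^ 'd"
  assumes ab: "square_integrable M a" "square_integrable M b"
    and g: "is_cond_exp M G (\<lambda>\<omega>. a \<omega> + w \<omega> *\<^sub>R b \<omega>) g"
    and h: "square_integrable M h" "h \<in> borel_measurable G"
  shows "(\<integral>\<omega>. g \<omega> \<bullet> h \<omega> \<partial>M) = (\<integral>\<omega>. (a \<omega> + w \<omega> *\<^sub>R b \<omega>) \<bullet> h \<omega> \<partial>M)"
proof -
  let ?f = "\<lambda>\<omega>. a \<omega> + w \<omega> *\<^sub>R b \<omega>"
  have [measurable]: "a \<in> borel_measurable M" "b \<in> borel_measurable M" "h \<in> borel_measurable M"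
    using ab h by (auto simp: square_integrable_def)
  have [measurable]: "g \<in> borel_measurable M"
    using g by (auto simp: is_cond_exp_def intro: measurable_GM)
  have hi: "(\<lambda>\<omega>. h \<omega> $ i) \<in> borel_measurable G" for i
    using h(2) by measurable
  have int: "integrable M (\<lambda>\<omega>. h \<omega> $ i * ?f \<omega> $ i)" for i
    using integrable_affine_noise_inner[OF ab(1)[THEN square_integrable_vec_nth, of i]
        ab(2)[THEN square_integrable_vec_nth, of i] square_integrable_vec_nth[OF h(1), of i] hi]
    by (simp add: mult.commute)
  have fM: "(\<lambda>\<omega>. ?f \<omega> $ i) \<in> borel_measurable M" for i
    by measurable
  have "(\<integral>\<omega>. g \<omega> \<bullet> h \<omega> \<partial>M) = (\<integral>\<omega>. (\<Sum>i\<in>UNIV. h \<omega> $ i * real_cond_exp M G (\<lambda>\<omega>. ?f \<omega> $ i) \<omega>) \<partial>M)"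
  proof (rule integral_cong_AE)
    show "AE \<omega> in M. g \<omega> \<bullet> h \<omega> = (\<Sum>i\<in>UNIV. h \<omega> $ i * real_cond_exp M G (\<lambda>\<omega>. ?f \<omega> $ i) \<omega>)"
      using g by (auto simp: is_cond_exp_def inner_vec_def mult.commute)
  qed measurable
  also have "\<dots> = (\<Sum>i\<in>UNIV. \<integral>\<omega>. h \<omega> $ i * ?f \<omega> $ i \<partial>M)"
    using real_cond_exp_intg[OF int hi fM] by (subst Bochner_Integration.integral_sum) auto
  also have "\<dots> = (\<integral>\<omega>. ?f \<omega> \<bullet> h \<omega> \<partial>M)"
    using int by (subst Bochner_Integration.integral_sum[symmetric]) (auto simp: inner_vec_def mult.commute)
  finally show ?thesis .
qed

lemma is_cond_exp_zeroI:
  fixes f :: "'a \<Rightarrow> real ^ 'd"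
  assumes f: "integrable M f"
    and zero: "\<And>A i. A \<in> sets G \<Longrightarrow> (\<integral>\<omega>. f \<omega> \<bullet> (indicator A \<omega> *\<^sub>R axis i 1) \<partial>M) = 0"
  shows "is_cond_exp M G f (\<lambda>_. 0)"
proof -
  have "AE \<omega> in M. real_cond_exp M G (\<lambda>\<omega>. f \<omega> $ i) \<omega> = 0" for i
  proof (rule real_cond_exp_charact)
    fix A assume "A \<in> sets G"
    from zero[OF this, of i]
    show "(LINT \<omega>:A|M. f \<omega> $ i) = (LINT \<omega>:A|M. 0)"
      by (simp add: set_lebesgue_integral_def inner_axis)
  qed (use f integrable_vec_nth in auto)
  then have "AE \<omega> in M. \<forall>i. real_cond_exp M G (\<lambda>\<omega>. f \<omega> $ i) \<omega> = 0"
    by (simp add: AE_all_countable)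
  then show ?thesis
    using f by (auto simp: is_cond_exp_def vec_eq_iff)
qed

end

section \<open>The noise filtration\<close>

text \<open>The information available just before \<open>w k\<close> is revealed: the \<open>\<sigma>\<close>-algebra of \<^const>\<open>mf_filtration\<close>
  at time \<open>k - 1\<close>, except that at \<open>k = 0\<close> the latter is trivial whereas \<open>\<xi>\<close> need not be constant.\<close>

definition mf_past ::
  "'a measure \<Rightarrow> ('a \<Rightarrow> real ^ 'n) \<Rightarrow> (nat \<Rightarrow> 'a \<Rightarrow> real) \<Rightarrow> nat \<Rightarrow> 'a measure" where
  "mf_past M \<xi> w k = sigma (space M)
     ({\<xi> -` S \<inter> space M | S. S \<in> sets borel} \<union>
      {w i -` S \<inter> space M | i S. i < k \<and> S \<in> sets borel} \<union> null_sets M)"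

lemma mf_filtration_eq_past: "mf_filtration M \<xi> w (int k) = mf_past M \<xi> w (Suc k)"
  by (simp add: mf_filtration_def mf_past_def less_Suc_eq_le)

locale mf_noise = prob_space M for M :: "'a measure" +
  fixes N :: nat and \<sigma> :: real and w :: "nat \<Rightarrow> 'a \<Rightarrow> real" and \<xi> :: "'a \<Rightarrow> real ^ 'n"
  assumes noise: "white_noise M N \<sigma> w"
    and init_meas [measurable]: "\<xi> \<in> borel_measurable M"
    and init_L2: "integrable M (\<lambda>\<omega>. (norm (\<xi> \<omega>))\<^sup>2)"
    and init_indep: "indep_set
          (sets (vimage_algebra (space M) \<xi> borel))
          (sets (vimage_algebra (space M) (\<lambda>\<omega>. \<lambda>k\<in>{..N}. w k \<omega>) (PiM {..N} (\<lambda>_. borel))))"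
begin

abbreviation "F \<equiv> mf_filtration M \<xi> w"
abbreviation "H \<equiv> mf_past M \<xi> w"

lemma noise_measurable: "k \<le> N \<Longrightarrow> w k \<in> borel_measurable M"
  using noise by (simp add: white_noise_def indep_vars_def2)

lemma space_past: "space (H k) = space M"
  unfolding mf_past_def by (rule space_measure_of) (auto dest: null_setsD2 sets.sets_into_space)

lemma sets_past: "sets (H k) = sigma_sets (space M)
     ({\<xi> -` S \<inter> space M | S. S \<in> sets borel} \<union>
      {w i -` S \<inter> space M | i S. i < k \<and> S \<in> sets borel} \<union> null_sets M)"
  unfolding mf_past_def by (rule sets_measure_of) (auto dest: null_setsD2 sets.sets_into_space)

lemma subalgebra_past: "k \<le> Suc N \<Longrightarrow> subalgebra M (H k)"
  unfolding subalgebra_def space_past sets_past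
  using noise_measurable init_meas
  by (auto intro!: sets.sigma_sets_subset measurable_sets)

lemma subalgebra_past_Suc: "subalgebra (H (Suc k)) (H k)"
  unfolding subalgebra_def space_past sets_past
  by (intro conjI refl sigma_sets_mono' Un_mono order_refl) (blast intro: less_SucI)

lemma space_filtration: "space (F t) = space M"
proof (cases "t < 0")
  case False
  then show ?thesis
    using mf_filtration_eq_past[of M \<xi> w "nat t"] by (simp add: space_past)
qed (simp add: mf_filtration_def space_measure_of_conv)

lemma subalgebra_filtration: "subalgebra (H k) (F (int k - 1))"
proof (cases k)
  case 0
  then have "sets (F (int k - 1)) \<subseteq> sets (H k)"
    using sets.top[of "H k"] by (auto simp: mf_filtration_def sigma_sets_empty_eq space_past)
  then show ?thesis by (simp add: subalgebra_def space_past space_filtration)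
next
  case (Suc j)
  then show ?thesis by (simp add: mf_filtration_eq_past subalgebra_def)
qed

lemma measurable_init_past: "\<xi> \<in> borel_measurable (H k)"
  by (rule measurableI) (auto simp: space_past sets_past intro!: sigma_sets.Basic)

lemma measurable_noise_past: "w k \<in> borel_measurable (H (Suc k))"
  by (rule measurableI) (auto simp: space_past sets_past intro!: sigma_sets.Basic)

lemma indep_sets_null_init_noise:
  "indep_sets (case_nat (null_sets M) (case_nat {\<xi> -` S \<inter> space M | S. S \<in> sets borel}
      (\<lambda>i. {w i -` S \<inter> space M | S. S \<in> sets borel}))) {..Suc (Suc N)}"
  (is "indep_sets ?E _")
proof (rule indep_setsI)
  show "?E j \<subseteq> events" if "j \<in> {..Suc (Suc N)}" for j
    using that init_meas noise_measurable by (auto split: nat.split intro: measurable_sets)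
next
  fix X J
  assume J: "J \<noteq> {}" "J \<subseteq> {..Suc (Suc N)}" "finite J" and X: "\<forall>j\<in>J. X j \<in> ?E j"
  show "prob (\<Inter>j\<in>J. X j) = (\<Prod>j\<in>J. prob (X j))"
  proof (cases "0 \<in> J")
    case True
    then have X0: "X 0 \<in> null_sets M" using X by force
    then have "prob (X 0) = 0" by (simp add: measure_eq_0_null_sets)
    moreover have "prob (\<Inter>j\<in>J. X j) \<le> prob (X 0)"
      using True X0 by (intro finite_measure_mono) auto
    ultimately have "prob (\<Inter>j\<in>J. X j) = 0"
      using measure_nonneg[of M "\<Inter>j\<in>J. X j"] by linarith
    then show ?thesis
      using True \<open>prob (X 0) = 0\<close> J(3) by (simp add: prod_zero_iff) blast
  next
    case False
    define K where "K = {i. Suc (Suc i) \<in> J}"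
    define Y where "Y = (\<Inter>i\<in>K. X (Suc (Suc i)))"
    have K: "finite K" "K \<subseteq> {..N}"
      using J finite_vimageI[OF J(3), of "\<lambda>i. Suc (Suc i)"]
      by (auto simp: K_def vimage_def inj_def)
    have XK: "\<forall>i\<in>K. X (Suc (Suc i)) \<in> {w i -` S \<inter> space M | S. S \<in> sets borel}"
      using X by (force simp: K_def)
    have "indep_sets (\<lambda>i. {w i -` S \<inter> space M | S. S \<in> sets borel}) {..N}"
      using noise by (simp add: white_noise_def indep_vars_def2)
    from indep_setsD[OF this K(2) _ K(1) XK]
    have Y_prod: "K \<noteq> {} \<Longrightarrow> prob Y = (\<Prod>i\<in>K. prob (X (Suc (Suc i))))"
      by (simp add: Y_def)
    have J_eq: "J = (if Suc 0 \<in> J then {Suc 0} else {}) \<union> (\<lambda>i. Suc (Suc i)) ` K"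
    proof -
      have "J \<subseteq> (if Suc 0 \<in> J then {Suc 0} else {}) \<union> (\<lambda>i. Suc (Suc i)) ` K"
      proof
        fix j assume "j \<in> J"
        then show "j \<in> (if Suc 0 \<in> J then {Suc 0} else {}) \<union> (\<lambda>i. Suc (Suc i)) ` K"
          using False by (cases j; cases "j - 1") (auto simp: K_def)
      qed
      moreover have "(\<lambda>i. Suc (Suc i)) ` K \<subseteq> J" by (auto simp: K_def)
      ultimately show ?thesis by (intro equalityI) (simp_all split: if_split)
    qed
    have prod_K: "(\<Prod>j\<in>(\<lambda>i. Suc (Suc i)) ` K. prob (X j)) = (\<Prod>i\<in>K. prob (X (Suc (Suc i))))"
      by (subst prod.reindex) (auto simp: inj_on_def)
    show ?thesis
    proof (cases "Suc 0 \<in> J")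
      case False
      then have "J = (\<lambda>i. Suc (Suc i)) ` K" using J_eq by simp
      then show ?thesis
        using Y_prod prod_K J(1) by (auto simp: Y_def)
    next
      case True
      then have J_eq': "J = insert (Suc 0) ((\<lambda>i. Suc (Suc i)) ` K)" using J_eq by auto
      obtain S where S: "S \<in> sets borel" "X (Suc 0) = \<xi> -` S \<inter> space M"
        using X True by force
      show ?thesis
      proof (cases "K = {}")
        case True
        then show ?thesis using J_eq' by simp
      next
        case False
        let ?w = "\<lambda>\<omega>. \<lambda>k\<in>{..N}. w k \<omega>"
        let ?V = "vimage_algebra (space M) ?w (PiM {..N} (\<lambda>_. borel))"
        have wV: "w i \<in> borel_measurable ?V" if "i \<in> K" for i
        proof -
          have "?w \<in> measurable ?V (PiM {..N} (\<lambda>_. borel))"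
            by (rule measurable_vimage_algebra1) (auto simp: space_PiM)
          from measurable_compose[OF this measurable_component_singleton[of i]]
          show ?thesis using subsetD[OF K(2) that] by simp
        qed
        have "X (Suc (Suc i)) \<in> sets ?V" if "i \<in> K" for i
          using XK that measurable_sets[OF wV[OF that]] by force
        then have "Y \<in> sets ?V"
          unfolding Y_def using K(1) False by (intro sets.finite_INT) auto
        moreover have "X (Suc 0) \<in> sets (vimage_algebra (space M) \<xi> borel)"
          using S by (auto simp: sets_vimage_algebra2)
        ultimately have "prob (X (Suc 0) \<inter> Y) = prob (X (Suc 0)) * prob Y"
          using indep_setD[OF init_indep] by blast
        moreover have "Suc 0 \<notin> (\<lambda>i. Suc (Suc i)) ` K" by auto
        ultimately show ?thesis
          unfolding J_eq' using Y_prod[OF False] prod_K K(1) by (simp add: Y_def)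
      qed
    qed
  qed
qed

lemma indep_noise_past:
  assumes "k \<le> N"
  shows "indep_set (sigma_sets (space M) {w k -` S \<inter> space M | S. S \<in> sets borel}) (sets (H k))"
proof -
  let ?E = "case_nat (null_sets M) (case_nat {\<xi> -` S \<inter> space M | S. S \<in> sets borel}
      (\<lambda>i. {w i -` S \<inter> space M | S. S \<in> sets borel}))"
  let ?I = "case_bool {Suc (Suc k)} {..<Suc (Suc k)}"
  have vimage_stable: "Int_stable {f -` S \<inter> space M | S. S \<in> sets borel}"
    for f :: "'a \<Rightarrow> 'c::topological_space"
    unfolding Int_stable_def
  proof safe
    fix S T :: "'c set" assume "S \<in> sets borel" "T \<in> sets borel"
    then show "\<exists>U. f -` S \<inter> space M \<inter> (f -` T \<inter> space M) = f -` U \<inter> space M \<and> U \<in> sets borel"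
      by (intro exI[of _ "S \<inter> T"]) auto
  qed
  have "indep_sets (\<lambda>j. sigma_sets (space M) (\<Union>i\<in>?I j. ?E i)) UNIV"
  proof (rule indep_sets_collect_sigma)
    show "indep_sets ?E (\<Union>j\<in>UNIV. ?I j)"
      using assms by (intro indep_sets_mono_index[OF _ indep_sets_null_init_noise])
        (auto simp: UNIV_bool)
    show "Int_stable (?E i)" for i
    proof (cases i)
      case 0
      then show ?thesis by (auto simp: Int_stable_def)
    next
      case (Suc n)
      then show ?thesis by (cases n) (simp_all only: nat.case vimage_stable)
    qed
    show "disjoint_family_on ?I UNIV"
      by (auto simp: disjoint_family_on_def split: bool.splits)
  qed
  then show ?thesis
    unfolding indep_set_def
  proof (rule indep_sets_mono_sets)
    have "sets (H k) \<subseteq> sigma_sets (space M) (\<Union>i\<in>{..<Suc (Suc k)}. ?E i)"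
      unfolding sets_past
    proof (rule sigma_sets_mono', intro Un_least subsetI)
      fix S assume "S \<in> {w i -` S \<inter> space M | i S. i < k \<and> S \<in> sets borel}"
      then obtain i T where "S = w i -` T \<inter> space M" "i < k" "T \<in> sets borel" by auto
      then show "S \<in> (\<Union>i\<in>{..<Suc (Suc k)}. ?E i)"
        by (intro UN_I[of "Suc (Suc i)"]) auto
    next
      fix S assume "S \<in> {\<xi> -` S \<inter> space M | S. S \<in> sets borel}"
      then show "S \<in> (\<Union>i\<in>{..<Suc (Suc k)}. ?E i)"
        by (intro UN_I[of "Suc 0"]) auto
    next
      fix S assume "S \<in> null_sets M"
      then show "S \<in> (\<Union>i\<in>{..<Suc (Suc k)}. ?E i)"
        by (intro UN_I[of 0]) auto
    qed
    then show "case_bool (sigma_sets (space M) {w k -` S \<inter> space M | S. S \<in> sets borel}) (sets (H k)) j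
        \<subseteq> sigma_sets (space M) (\<Union>i\<in>?I j. ?E i)" for j
      by (cases j) auto
  qed
qed

lemma step:
  assumes "k \<le> N"
  shows "white_step_conditional M (H k) (w k) (\<sigma>\<^sup>2) (F (int k - 1))"
proof unfold_locales
  show "(\<integral>\<omega>. (w k \<omega>)\<^sup>2 \<partial>M) = \<sigma>\<^sup>2"
    using noise assms by (auto simp: white_noise_def)
qed (use assms noise subalgebra_past subalgebra_filtration indep_noise_past noise_measurable in
    \<open>auto simp: white_noise_def\<close>)

end

section \<open>Quadratic cost and state dynamics\<close>

declare mf_state.simps(2) [simp del] transpose_matrix_vector [simp del]

definition mf_bilinear ::
  "'a measure \<Rightarrow> nat \<Rightarrow>
   (nat \<Rightarrow> real ^ 'n ^ 'n) \<Rightarrow> (nat \<Rightarrow> real ^ 'n ^ 'n) \<Rightarrow>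
   (nat \<Rightarrow> real ^ 'm ^ 'm) \<Rightarrow> (nat \<Rightarrow> real ^ 'm ^ 'm) \<Rightarrow>
   real ^ 'n ^ 'n \<Rightarrow> real ^ 'n ^ 'n \<Rightarrow>
   (nat \<Rightarrow> 'a \<Rightarrow> real ^ 'n) \<Rightarrow> (nat \<Rightarrow> 'a \<Rightarrow> real ^ 'm) \<Rightarrow>
   (nat \<Rightarrow> 'a \<Rightarrow> real ^ 'n) \<Rightarrow> (nat \<Rightarrow> 'a \<Rightarrow> real ^ 'm) \<Rightarrow> real" where
  "mf_bilinear M N Q Qbar R Rbar P Pbar x u y v =
     (\<Sum>k\<le>N. (\<integral>\<omega>. x k \<omega> \<bullet> (Q k *v y k \<omega>) \<partial>M)
       + integral\<^sup>L M (x k) \<bullet> (Qbar k *v integral\<^sup>L M (y k))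
       + (\<integral>\<omega>. u k \<omega> \<bullet> (R k *v v k \<omega>) \<partial>M)
       + integral\<^sup>L M (u k) \<bullet> (Rbar k *v integral\<^sup>L M (v k)))
     + (\<integral>\<omega>. x (Suc N) \<omega> \<bullet> (P *v y (Suc N) \<omega>) \<partial>M)
     + integral\<^sup>L M (x (Suc N)) \<bullet> (Pbar *v integral\<^sup>L M (y (Suc N)))"

lemma inner_symmetric_matrix:
  fixes S :: "real ^ 'n ^ 'n"
  assumes "transpose S = S"
  shows "(S *v x) \<bullet> y = x \<bullet> (S *v y)"
  using inner_transpose_left[of S x y] assms by simp

lemma quadratic_form_add:
  fixes S :: "real ^ 'n ^ 'n"
  assumes "transpose S = S"
  shows "(a + t *\<^sub>R b) \<bullet> (S *v (a + t *\<^sub>R b)) = a \<bullet> (S *v a) + 2 * t * (a \<bullet> (S *v b)) + t\<^sup>2 * (b \<bullet> (S *v b))"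
  using inner_symmetric_matrix[OF assms, of a b]
  by (simp add: matrix_vector_right_distrib matrix_vector_mult_scaleR inner_add_left inner_add_right
      inner_commute[of b] power2_eq_square algebra_simps)

lemma integral_quadratic_form_add:
  fixes S :: "real ^ 'n ^ 'n"
  assumes "transpose S = S" "square_integrable M f" "square_integrable M g"
  shows "(\<integral>\<omega>. (f \<omega> + t *\<^sub>R g \<omega>) \<bullet> (S *v (f \<omega> + t *\<^sub>R g \<omega>)) \<partial>M)
    = (\<integral>\<omega>. f \<omega> \<bullet> (S *v f \<omega>) \<partial>M) + 2 * t * (\<integral>\<omega>. f \<omega> \<bullet> (S *v g \<omega>) \<partial>M) + t\<^sup>2 * (\<integral>\<omega>. g \<omega> \<bullet> (S *v g \<omega>) \<partial>M)"
  unfolding quadratic_form_add[OF assms(1)]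
  using assms by (simp add: square_integrable_inner square_integrable_mult_vec)

lemma nonneg_perturbation_linear_zero:
  fixes b c :: real
  assumes nonneg: "\<And>t. 0 \<le> 2 * t * b + t\<^sup>2 * c"
  shows "b = 0"
proof (rule ccontr)
  assume "b \<noteq> 0"
  define d where "d = \<bar>c\<bar> + 1"
  have d: "d > 0" "c < d" by (auto simp: d_def)
  have "0 \<le> 2 * (- b / d) * b + (- b / d)\<^sup>2 * c" by (rule nonneg)
  also have "\<dots> = (b\<^sup>2 / d) * (c / d - 2)"
    using d by (simp add: field_simps power2_eq_square)
  also have "\<dots> < 0"
    using d \<open>b \<noteq> 0\<close> by (intro mult_pos_neg) (auto simp: field_simps)
  finally show False by simp
qed

context prob_space
begin

lemma integral_add_scaleR:
  fixes f g :: "'a \<Rightarrow> 'b::euclidean_space"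
  assumes "square_integrable M f" "square_integrable M g"
  shows "(\<integral>\<omega>. f \<omega> + t *\<^sub>R g \<omega> \<partial>M) = integral\<^sup>L M f + t *\<^sub>R integral\<^sup>L M g"
  using assms by (simp add: square_integrable_integrable)

lemma mf_cost_eq_bilinear:
  assumes "\<And>k. k \<le> Suc N \<Longrightarrow> square_integrable M (x k)" "\<And>k. k \<le> N \<Longrightarrow> square_integrable M (u k)"
  shows "mf_cost M N Q Qbar R Rbar P Pbar x u = mf_bilinear M N Q Qbar R Rbar P Pbar x u x u"
proof -
  have "(\<integral>\<omega>. (x k \<omega> \<bullet> (Q k *v x k \<omega>) + integral\<^sup>L M (x k) \<bullet> (Qbar k *v integral\<^sup>L M (x k))
          + u k \<omega> \<bullet> (R k *v u k \<omega>) + integral\<^sup>L M (u k) \<bullet> (Rbar k *v integral\<^sup>L M (u k))) \<partial>M)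
      = (\<integral>\<omega>. x k \<omega> \<bullet> (Q k *v x k \<omega>) \<partial>M) + integral\<^sup>L M (x k) \<bullet> (Qbar k *v integral\<^sup>L M (x k))
        + (\<integral>\<omega>. u k \<omega> \<bullet> (R k *v u k \<omega>) \<partial>M) + integral\<^sup>L M (u k) \<bullet> (Rbar k *v integral\<^sup>L M (u k))"
    if "k \<le> N" for k
    using that assms by (simp add: square_integrable_inner square_integrable_mult_vec prob_space)
  then show ?thesis
    by (simp add: mf_cost_def mf_bilinear_def)
qed

lemma mf_bilinear_perturb:
  assumes L2: "\<And>k. k \<le> Suc N \<Longrightarrow> square_integrable M (x k)" "\<And>k. k \<le> N \<Longrightarrow> square_integrable M (u k)"
      "\<And>k. k \<le> Suc N \<Longrightarrow> square_integrable M (y k)" "\<And>k. k \<le> N \<Longrightarrow> square_integrable M (v k)"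
    and sym: "\<And>k. k \<le> N \<Longrightarrow> transpose (Q k) = Q k \<and> transpose (Qbar k) = Qbar k \<and>
                transpose (R k) = R k \<and> transpose (Rbar k) = Rbar k"
      "transpose P = P" "transpose Pbar = Pbar"
    and x': "\<And>k. k \<le> Suc N \<Longrightarrow> x' k = (\<lambda>\<omega>. x k \<omega> + t *\<^sub>R y k \<omega>)"
    and u': "\<And>k. k \<le> N \<Longrightarrow> u' k = (\<lambda>\<omega>. u k \<omega> + t *\<^sub>R v k \<omega>)"
  shows "mf_bilinear M N Q Qbar R Rbar P Pbar x' u' x' u' =
    mf_bilinear M N Q Qbar R Rbar P Pbar x u x u
    + 2 * t * mf_bilinear M N Q Qbar R Rbar P Pbar x u y v
    + t\<^sup>2 * mf_bilinear M N Q Qbar R Rbar P Pbar y v y v"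
proof -
  define q where "q x u y v k = (\<integral>\<omega>. x k \<omega> \<bullet> (Q k *v y k \<omega>) \<partial>M)
       + integral\<^sup>L M (x k) \<bullet> (Qbar k *v integral\<^sup>L M (y k))
       + (\<integral>\<omega>. u k \<omega> \<bullet> (R k *v v k \<omega>) \<partial>M)
       + integral\<^sup>L M (u k) \<bullet> (Rbar k *v integral\<^sup>L M (v k))" for x u y v k
  define p where "p x y = (\<integral>\<omega>. x (Suc N) \<omega> \<bullet> (P *v y (Suc N) \<omega>) \<partial>M)
     + integral\<^sup>L M (x (Suc N)) \<bullet> (Pbar *v integral\<^sup>L M (y (Suc N)))" for x y
  have b: "mf_bilinear M N Q Qbar R Rbar P Pbar x u y v = (\<Sum>k\<le>N. q x u y v k) + p x y" for x u y v
    by (simp add: mf_bilinear_def q_def p_def)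
  have "q x' u' x' u' k = q x u x u k + 2 * t * q x u y v k + t\<^sup>2 * q y v y v k" if "k \<le> N" for k
  proof -
    have k: "k \<le> Suc N" using that by simp
    note sq = L2(1)[OF k] L2(2)[OF that] L2(3)[OF k] L2(4)[OF that]
    note S = sym(1)[OF that, THEN conjunct1] sym(1)[OF that, THEN conjunct2, THEN conjunct1]
      sym(1)[OF that, THEN conjunct2, THEN conjunct2, THEN conjunct1]
      sym(1)[OF that, THEN conjunct2, THEN conjunct2, THEN conjunct2]
    show ?thesis
      unfolding q_def x'[OF k] u'[OF that] integral_quadratic_form_add[OF S(1) sq(1,3)]
        integral_quadratic_form_add[OF S(3) sq(2,4)] integral_add_scaleR[OF sq(1,3)]
        integral_add_scaleR[OF sq(2,4)] quadratic_form_add[OF S(2)] quadratic_form_add[OF S(4)]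
      by (simp add: ring_distribs)
  qed
  then have "(\<Sum>k\<le>N. q x' u' x' u' k)
      = (\<Sum>k\<le>N. q x u x u k + 2 * t * q x u y v k + t\<^sup>2 * q y v y v k)"
    by (intro sum.cong) auto
  moreover have "p x' x' = p x x + 2 * t * p x y + t\<^sup>2 * p y y"
    unfolding p_def x'[OF order_refl] integral_quadratic_form_add[OF sym(2) L2(1,3)[OF order_refl]]
      integral_add_scaleR[OF L2(1,3)[OF order_refl]] quadratic_form_add[OF sym(3)]
    by (simp add: ring_distribs)
  ultimately show ?thesis
    unfolding b by (simp add: sum.distrib sum_distrib_left algebra_simps)
qed

end

locale mf_system = mf_noise M N \<sigma> w \<xi> for M :: "'a measure" and N \<sigma> w and \<xi> :: "'a \<Rightarrow> real ^ 'n" +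
  fixes A Abar C Cbar :: "nat \<Rightarrow> real ^ 'n ^ 'n"
    and B Bbar D Dbar :: "nat \<Rightarrow> real ^ 'm ^ 'n"
begin

abbreviation "state \<equiv> mf_state M A Abar B Bbar C Cbar D Dbar w"

lemma state_past_square_integrable:
  assumes init: "\<zeta> \<in> borel_measurable (H 0)" "square_integrable M \<zeta>"
    and v: "\<And>k. k \<le> N \<Longrightarrow> v k \<in> borel_measurable (H k)" "\<And>k. k \<le> N \<Longrightarrow> square_integrable M (v k)"
    and "k \<le> Suc N"
  shows "state \<zeta> v k \<in> borel_measurable (H k) \<and> square_integrable M (state \<zeta> v k)"
  using \<open>k \<le> Suc N\<close>
proof (induction k)
  case 0
  then show ?case using init by simp
next
  case (Suc k)
  then have k: "k \<le> N" by simp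
  interpret white_step_conditional M "H k" "w k" "\<sigma>\<^sup>2" "F (int k - 1)" by (rule step[OF k])
  define x where "x = state \<zeta> v k"
  have x: "x \<in> borel_measurable (H k)" "square_integrable M x"
    using Suc by (auto simp: x_def)
  have eq: "state \<zeta> v (Suc k) = (\<lambda>\<omega>.
      (A k *v x \<omega> + Abar k *v integral\<^sup>L M x + B k *v v k \<omega> + Bbar k *v integral\<^sup>L M (v k))
      + w k \<omega> *\<^sub>R (C k *v x \<omega> + Cbar k *v integral\<^sup>L M x + D k *v v k \<omega> + Dbar k *v integral\<^sup>L M (v k)))"
    by (simp add: mf_state.simps(2) Let_def x_def)
  have affine: "(\<lambda>\<omega>. S k *v x \<omega> + c + T k *v v k \<omega> + d) \<in> borel_measurable (H k)"
      "square_integrable M (\<lambda>\<omega>. S k *v x \<omega> + c + T k *v v k \<omega> + d)"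
    for S :: "nat \<Rightarrow> real ^ 'n ^ 'n" and T :: "nat \<Rightarrow> real ^ 'm ^ 'n" and c d
    using x v[OF k] by (auto intro!: borel_measurable_add measurable_mult_vec
        square_integrable_add square_integrable_mult_vec)
  have up: "f \<in> borel_measurable (H k) \<Longrightarrow> f \<in> borel_measurable (H (Suc k))"
    for f :: "'a \<Rightarrow> real ^ 'n"
    by (rule measurable_from_subalg[OF subalgebra_past_Suc])
  show ?case
    unfolding eq
    by (intro conjI borel_measurable_add[OF up[OF affine(1)]]
        borel_measurable_scaleR[OF measurable_noise_past up[OF affine(1)]]
        square_integrable_add[OF affine(2)] noise_times_square_integrable affine)
qed

lemma integral_state_Suc:
  assumes k: "k \<le> N"
    and x: "state \<zeta> v k \<in> borel_measurable (H k)" "square_integrable M (state \<zeta> v k)"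
    and v: "v k \<in> borel_measurable (H k)" "square_integrable M (v k)"
  shows "integral\<^sup>L M (state \<zeta> v (Suc k)) =
    (A k + Abar k) *v integral\<^sup>L M (state \<zeta> v k) + (B k + Bbar k) *v integral\<^sup>L M (v k)"
proof -
  interpret white_step_conditional M "H k" "w k" "\<sigma>\<^sup>2" "F (int k - 1)" by (rule step[OF k])
  define x where "x = state \<zeta> v k"
  define d where "d = (\<lambda>\<omega>. C k *v x \<omega> + Cbar k *v integral\<^sup>L M x + D k *v v k \<omega> + Dbar k *v integral\<^sup>L M (v k))"
  have d: "d \<in> borel_measurable (H k)" "square_integrable M d"
    using x v unfolding d_def x_def
    by (auto intro!: borel_measurable_add measurable_mult_vec square_integrable_add square_integrable_mult_vec)
  have int: "integrable M x" "integrable M (v k)" "integrable M (\<lambda>\<omega>. w k \<omega> *\<^sub>R d \<omega>)"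
    using x v noise_times_square_integrable(1)[OF d(2,1)]
    by (auto simp: x_def square_integrable_integrable)
  have "integral\<^sup>L M (state \<zeta> v (Suc k)) = (\<integral>\<omega>. (A k *v x \<omega> + Abar k *v integral\<^sup>L M x
      + B k *v v k \<omega> + Bbar k *v integral\<^sup>L M (v k)) + w k \<omega> *\<^sub>R d \<omega> \<partial>M)"
    by (simp add: mf_state.simps(2) Let_def x_def d_def)
  also have "\<dots> = A k *v integral\<^sup>L M x + Abar k *v integral\<^sup>L M x
      + B k *v integral\<^sup>L M (v k) + Bbar k *v integral\<^sup>L M (v k)"
    using int integral_noise_times[OF d(2,1)]
    by (simp add: integrable_mult_vec integral_mult_vec prob_space)
  finally show ?thesis
    by (simp add: x_def matrix_vector_mult_add_rdistrib)
qed

lemma state_perturb: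
  assumes init: "\<zeta> \<in> borel_measurable (H 0)" "square_integrable M \<zeta>"
    and u: "\<And>k. k \<le> N \<Longrightarrow> u k \<in> borel_measurable (H k)" "\<And>k. k \<le> N \<Longrightarrow> square_integrable M (u k)"
    and v: "\<And>k. k \<le> N \<Longrightarrow> v k \<in> borel_measurable (H k)" "\<And>k. k \<le> N \<Longrightarrow> square_integrable M (v k)"
    and "k \<le> Suc N"
  shows "state \<zeta> (\<lambda>k \<omega>. u k \<omega> + t *\<^sub>R v k \<omega>) k = (\<lambda>\<omega>. state \<zeta> u k \<omega> + t *\<^sub>R state (\<lambda>_. 0) v k \<omega>)"
  using \<open>k \<le> Suc N\<close>
proof (induction k)
  case (Suc k)
  then have k: "k \<le> N" by simp
  note x = state_past_square_integrable[where k = k, OF init u, THEN conjunct2]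
  note y = state_past_square_integrable[where k = k, OF _ square_integrable_const v, THEN conjunct2]
  have "integral\<^sup>L M (state \<zeta> (\<lambda>k \<omega>. u k \<omega> + t *\<^sub>R v k \<omega>) k)
      = integral\<^sup>L M (state \<zeta> u k) + t *\<^sub>R integral\<^sup>L M (state (\<lambda>_. 0) v k)"
    using Suc k x y by (simp add: integral_add_scaleR)
  moreover have "(\<integral>\<omega>. u k \<omega> + t *\<^sub>R v k \<omega> \<partial>M) = integral\<^sup>L M (u k) + t *\<^sub>R integral\<^sup>L M (v k)"
    using k u v by (simp add: integral_add_scaleR)
  ultimately show ?case
    using Suc k
    by (simp add: mf_state.simps(2) Let_def matrix_vector_right_distrib matrix_vector_mult_scaleR scaleR_add_right
        mult.commute add_ac)
qed simp

end

section \<open>Duality with the costate\<close>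

locale mf_control = mf_system M N \<sigma> w \<xi> A Abar C Cbar B Bbar D Dbar
  for M :: "'a measure" and N \<sigma> w and \<xi> :: "'a \<Rightarrow> real ^ 'n"
    and A Abar C Cbar and B Bbar D Dbar :: "nat \<Rightarrow> real ^ 'm ^ 'n" +
  fixes Q Qbar :: "nat \<Rightarrow> real ^ 'n ^ 'n" and R Rbar :: "nat \<Rightarrow> real ^ 'm ^ 'm"
    and P Pbar :: "real ^ 'n ^ 'n" and u :: "nat \<Rightarrow> 'a \<Rightarrow> real ^ 'm"
  assumes sym: "\<And>k. k \<le> N \<Longrightarrow> transpose (Q k) = Q k \<and> transpose (Qbar k) = Qbar k \<and>
                transpose (R k) = R k \<and> transpose (Rbar k) = Rbar k"
    and sym_terminal: "transpose P = P" "transpose Pbar = Pbar"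
    and admissible: "mf_admissible M F N u"
begin

abbreviation "x \<equiv> state \<xi> u"
abbreviation "Acal k \<omega> \<equiv> block_mat (A k + w k \<omega> *\<^sub>R C k) (Abar k + w k \<omega> *\<^sub>R Cbar k) 0 (A k + Abar k)"
abbreviation "Bcal k \<omega> \<equiv> vstack (B k + w k \<omega> *\<^sub>R D k) (0 :: real ^ 'm ^ 'n)"
abbreviation "Bmean k \<omega> \<equiv> vstack (Bbar k + w k \<omega> *\<^sub>R Dbar k) (B k + Bbar k)"
abbreviation "running k \<omega> \<equiv> Q k *v x k \<omega> + Qbar k *v integral\<^sup>L M (x k)"
abbreviation "costate_rhs k \<mu> \<omega> \<equiv> vstack (running k \<omega>) 0 + transpose (Acal k \<omega>) *v \<mu> \<omega>"
abbreviation "gradient k \<mu> \<omega> \<equiv> R k *v u k \<omega> + Rbar k *v integral\<^sup>L M (u k)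
    + transpose (Bcal k \<omega>) *v \<mu> \<omega> + (\<integral>\<omega>'. transpose (Bmean k \<omega>') *v \<mu> \<omega>' \<partial>M)"
abbreviation "polar \<equiv> mf_bilinear M N Q Qbar R Rbar P Pbar"
abbreviation "is_costate \<equiv> mf_costate M F N A Abar C Cbar Q Qbar P Pbar w x"

lemma admissibleD:
  assumes "mf_admissible M F N v" "k \<le> N"
  shows "v k \<in> borel_measurable (F (int k - 1))"
    and "v k \<in> borel_measurable (H k)"
    and "square_integrable M (v k)"
proof -
  interpret white_step_conditional M "H k" "w k" "\<sigma>\<^sup>2" "F (int k - 1)" by (rule step[OF assms(2)])
  show "v k \<in> borel_measurable (F (int k - 1))"
    using assms by (simp add: mf_admissible_def)
  from measurable_GH[OF this] measurable_GM[OF this]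
  show "v k \<in> borel_measurable (H k)" "square_integrable M (v k)"
    using assms by (auto simp: mf_admissible_def square_integrable_def)
qed

lemma state_admissible:
  assumes "\<zeta> \<in> borel_measurable (H 0)" "square_integrable M \<zeta>" "mf_admissible M F N v" "k \<le> Suc N"
  shows "state \<zeta> v k \<in> borel_measurable (H k)" "square_integrable M (state \<zeta> v k)"
  using state_past_square_integrable[of \<zeta> v k] admissibleD[OF assms(3)] assms by auto

lemma init_square_integrable: "square_integrable M \<xi>"
  using init_L2 init_meas by (simp add: square_integrable_def)

lemmas state_u = state_admissible[OF measurable_init_past init_square_integrable admissible]

lemmas state_variation = state_admissible[OF borel_measurable_const[of "0 :: real ^ 'n"] square_integrable_const]

lemma state_variation_adapted:
  assumes "mf_admissible M F N v" "k \<le> Suc N"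
  shows "state (\<lambda>_. 0) v k \<in> borel_measurable (F (int k - 1))"
proof (cases k)
  case (Suc j)
  then have "F (int k - 1) = H k"
    using mf_filtration_eq_past[of M \<xi> w j] by simp
  then show ?thesis using state_variation(1)[OF assms] by simp
qed simp

lemma running_square_integrable: "k \<le> N \<Longrightarrow> square_integrable M (running k)"
  using state_u(2)[of k] by (intro square_integrable_add square_integrable_mult_vec square_integrable_const) auto

lemma costate_rhs_affine:
  "costate_rhs k \<mu> \<omega> = (vstack (running k \<omega>) 0 + transpose (block_mat (A k) (Abar k) 0 (A k + Abar k)) *v \<mu> \<omega>)
    + w k \<omega> *\<^sub>R (transpose (block_mat (C k) (Cbar k) 0 0) *v \<mu> \<omega>)"
  unfolding block_mat_affine transpose_affine_mult_vec add.assoc ..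

lemma costate_rhs_affine_square_integrable:
  assumes "k \<le> N" "square_integrable M \<mu>"
  shows "square_integrable M (\<lambda>\<omega>. vstack (running k \<omega>) (0 :: real ^ 'n)
      + transpose (block_mat (A k) (Abar k) 0 (A k + Abar k)) *v \<mu> \<omega>)"
    and "square_integrable M (\<lambda>\<omega>. transpose (block_mat (C k) (Cbar k) 0 0) *v \<mu> \<omega>)"
  by (intro square_integrable_add square_integrable_vstack square_integrable_mult_vec
      running_square_integrable square_integrable_const assms)+

lemma costate_rhs_integrable:
  assumes "k \<le> N" "square_integrable M \<mu>"
  shows "integrable M (costate_rhs k \<mu>)"
proof -
  interpret white_step_conditional M "H k" "w k" "\<sigma>\<^sup>2" "F (int k - 1)" by (rule step[OF assms(1)])
  show ?thesis
    unfolding costate_rhs_affine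
    by (intro integrable_affine_noise costate_rhs_affine_square_integrable assms)
qed

lemma costate_step_square_integrable:
  assumes "k \<le> N" "square_integrable M \<mu>" "is_cond_exp M (F (int k - 1)) (costate_rhs k \<mu>) g"
  shows "square_integrable M g"
proof -
  interpret white_step_conditional M "H k" "w k" "\<sigma>\<^sup>2" "F (int k - 1)" by (rule step[OF assms(1)])
  show ?thesis
    by (rule square_integrable_is_cond_exp[OF costate_rhs_affine_square_integrable[OF assms(1,2)]
          assms(3)[unfolded costate_rhs_affine]])
qed

lemma terminal_square_integrable:
  "square_integrable M (\<lambda>\<omega>. block_mat P Pbar 0 0 *v vstack (x (Suc N) \<omega>) (integral\<^sup>L M (x (Suc N))))"
  by (intro square_integrable_mult_vec square_integrable_vstack state_u square_integrable_const) simp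

lemma costate_step:
  "is_costate l \<Longrightarrow> k \<le> N \<Longrightarrow> is_cond_exp M (F (int k - 1)) (costate_rhs k (l (int k))) (l (int k - 1))"
  by (simp add: mf_costate_def)

lemma costate_square_integrable:
  assumes l: "is_costate l" and "k \<le> N"
  shows "square_integrable M (l (int k))"
  using \<open>k \<le> N\<close>
proof (induction k rule: inc_induct)
  case base
  have "l (int N) \<in> borel_measurable (H (Suc N))"
    using l by (simp add: mf_costate_def mf_filtration_eq_past)
  then have "l (int N) \<in> borel_measurable M"
    using measurable_from_subalg[OF subalgebra_past] by blast
  moreover have "AE \<omega> in M. l (int N) \<omega>
      = block_mat P Pbar 0 0 *v vstack (x (Suc N) \<omega>) (integral\<^sup>L M (x (Suc N)))"
    using l by (simp add: mf_costate_def)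
  ultimately show ?case
    by (rule square_integrable_cong_AE[OF terminal_square_integrable])
next
  case (step k)
  have "is_cond_exp M (F (int (Suc k) - 1)) (costate_rhs (Suc k) (l (int (Suc k)))) (l (int (Suc k) - 1))"
    using step(2) by (intro costate_step[OF l]) simp
  from costate_step_square_integrable[OF _ step(3) this] show ?case
    using step(2) by simp
qed

lemma costate_exists: "\<exists>l. is_costate l"
proof -
  define L where "L = rec_nat
    (\<lambda>\<omega>. block_mat P Pbar 0 0 *v vstack (x (Suc N) \<omega>) (integral\<^sup>L M (x (Suc N))))
    (\<lambda>j \<mu> \<omega>. \<chi> i. real_cond_exp M (F (int (N - j) - 1)) (\<lambda>\<omega>. costate_rhs (N - j) \<mu> \<omega> $ i) \<omega>)"
  have L_0: "L 0 = (\<lambda>\<omega>. block_mat P Pbar 0 0 *v vstack (x (Suc N) \<omega>) (integral\<^sup>L M (x (Suc N))))"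
    by (simp add: L_def)
  have L_Suc: "L (Suc j) = (\<lambda>\<omega>. \<chi> i. real_cond_exp M (F (int (N - j) - 1)) (\<lambda>\<omega>. costate_rhs (N - j) (L j) \<omega> $ i) \<omega>)" for j
    by (simp add: L_def)
  have L_step: "is_cond_exp M (F (int (N - j) - 1)) (costate_rhs (N - j) (L j)) (L (Suc j))"
    if "square_integrable M (L j)" for j
  proof -
    interpret white_step_conditional M "H (N - j)" "w (N - j)" "\<sigma>\<^sup>2" "F (int (N - j) - 1)"
      by (rule step) simp
    show ?thesis
      unfolding L_Suc by (intro is_cond_exp_exists costate_rhs_integrable that) simp
  qed
  have L_sq: "square_integrable M (L j)" for j
  proof (induction j)
    case 0
    then show ?case unfolding L_0 by (rule terminal_square_integrable)
  next
    case (Suc j)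
    show ?case
      by (rule costate_step_square_integrable[OF _ Suc L_step[OF Suc]]) simp
  qed
  have "is_costate (\<lambda>t. L (nat (int N - t)))"
    unfolding mf_costate_def
  proof (intro conjI allI impI)
    have "L 0 \<in> borel_measurable (H (Suc N))"
      unfolding L_0 by (intro measurable_mult_vec measurable_vstack state_u borel_measurable_const) simp
    then show "L (nat (int N - int N)) \<in> borel_measurable (F (int N))"
      by (simp add: mf_filtration_eq_past)
    show "AE \<omega> in M. L (nat (int N - int N)) \<omega>
        = block_mat P Pbar 0 0 *v vstack (x (Suc N) \<omega>) (integral\<^sup>L M (x (Suc N)))"
      by (simp add: L_0)
    fix k assume k: "k \<le> N"
    then have "nat (int N - int k) = N - k" "nat (int N - (int k - 1)) = Suc (N - k)" "N - (N - k) = k"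
      by auto
    then show "is_cond_exp M (F (int k - 1)) (costate_rhs k (L (nat (int N - int k))))
        (L (nat (int N - (int k - 1))))"
      using L_step[OF L_sq, of "N - k"] by simp
  qed
  then show ?thesis by (rule exI[where P = is_costate])
qed

lemma Bcal_affine:
  "transpose (Bcal k \<omega>) *v \<mu> \<omega> = transpose (vstack (B k) (0 :: real ^ 'm ^ 'n)) *v \<mu> \<omega>
    + w k \<omega> *\<^sub>R (transpose (vstack (D k) (0 :: real ^ 'm ^ 'n)) *v \<mu> \<omega>)"
  by (simp only: vstack_affine transpose_affine_mult_vec)

lemma Bmean_affine:
  "transpose (Bmean k \<omega>) *v \<mu> \<omega> = transpose (vstack (Bbar k) (B k + Bbar k)) *v \<mu> \<omega>
    + w k \<omega> *\<^sub>R (transpose (vstack (Dbar k) (0 :: real ^ 'm ^ 'n)) *v \<mu> \<omega>)"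
  by (simp only: vstack_affine transpose_affine_mult_vec)

lemma gradient_integrable:
  assumes "k \<le> N" "square_integrable M \<mu>"
  shows "integrable M (\<lambda>\<omega>. transpose (Bmean k \<omega>) *v \<mu> \<omega>)" "integrable M (gradient k \<mu>)"
proof -
  interpret white_step_conditional M "H k" "w k" "\<sigma>\<^sup>2" "F (int k - 1)" by (rule step[OF assms(1)])
  show "integrable M (\<lambda>\<omega>. transpose (Bmean k \<omega>) *v \<mu> \<omega>)"
    unfolding Bmean_affine by (intro integrable_affine_noise square_integrable_mult_vec assms)
  show "integrable M (gradient k \<mu>)"
    unfolding Bcal_affine
    by (intro Bochner_Integration.integrable_add integrable_affine_noise square_integrable_mult_vec
        assms integrable_mult_vec square_integrable_integrable square_integrable_const
        admissibleD[OF admissible])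
qed

text \<open>Stacking the state variation \<open>y\<close> with its mean turns the mean-field dynamics into an ordinary
  linear recursion driven by the matrices of the costate equation.\<close>

lemma costate_duality_step:
  assumes k: "k \<le> N" and \<mu>: "square_integrable M \<mu>"
    and g: "is_cond_exp M (F (int k - 1)) (costate_rhs k \<mu>) g"
    and v: "mf_admissible M F N v"
  defines "y \<equiv> state (\<lambda>_. 0) v"
  defines "z \<equiv> \<lambda>k \<omega>. vstack (y k \<omega>) (integral\<^sup>L M (y k))"
  shows "(\<integral>\<omega>. \<mu> \<omega> \<bullet> z (Suc k) \<omega> \<partial>M) + ((\<integral>\<omega>. x k \<omega> \<bullet> (Q k *v y k \<omega>) \<partial>M)
      + integral\<^sup>L M (x k) \<bullet> (Qbar k *v integral\<^sup>L M (y k))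
      + (\<integral>\<omega>. u k \<omega> \<bullet> (R k *v v k \<omega>) \<partial>M)
      + integral\<^sup>L M (u k) \<bullet> (Rbar k *v integral\<^sup>L M (v k)))
    = (\<integral>\<omega>. g \<omega> \<bullet> z k \<omega> \<partial>M) + (\<integral>\<omega>. gradient k \<mu> \<omega> \<bullet> v k \<omega> \<partial>M)"
proof -
  interpret white_step_conditional M "H k" "w k" "\<sigma>\<^sup>2" "F (int k - 1)" by (rule step[OF k])
  note uk = admissibleD[OF admissible k] and vk = admissibleD[OF v k]
  have k': "k \<le> Suc N" using k by simp
  note xk = state_u[OF k']
  have yk: "square_integrable M (y k)" "y k \<in> borel_measurable (F (int k - 1))" "y k \<in> borel_measurable (H k)"
    using state_variation[OF v k'] state_variation_adapted[OF v k'] by (auto simp: y_def)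
  have zk: "square_integrable M (z k)" "z k \<in> borel_measurable (F (int k - 1))"
    unfolding z_def by (intro square_integrable_vstack measurable_vstack yk square_integrable_const
        borel_measurable_const)+
  have Eu: "integrable M (u k)" and Ev: "integrable M (v k)" and Ex: "integrable M (x k)" and Ey: "integrable M (y k)"
    using uk vk xk yk by (auto intro: square_integrable_integrable)
  have int_run: "integrable M (\<lambda>\<omega>. vstack (running k \<omega>) 0 \<bullet> z k \<omega>)"
    by (intro square_integrable_inner square_integrable_vstack running_square_integrable k zk square_integrable_const)
  have int_A: "integrable M (\<lambda>\<omega>. (transpose (Acal k \<omega>) *v \<mu> \<omega>) \<bullet> z k \<omega>)"
    unfolding block_mat_affine transpose_affine_mult_vec
    by (intro integrable_affine_noise_inner square_integrable_mult_vec \<mu> zk)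
  have int_B: "integrable M (\<lambda>\<omega>. (transpose (Bcal k \<omega>) *v \<mu> \<omega>) \<bullet> v k \<omega>)"
    unfolding Bcal_affine by (intro integrable_affine_noise_inner square_integrable_mult_vec \<mu> vk)
  note int_Bm = gradient_integrable(1)[OF k \<mu>]

  have "(\<integral>\<omega>. g \<omega> \<bullet> z k \<omega> \<partial>M) = (\<integral>\<omega>. costate_rhs k \<mu> \<omega> \<bullet> z k \<omega> \<partial>M)"
    using integral_is_cond_exp_inner[OF costate_rhs_affine_square_integrable[OF k \<mu>]
        g[unfolded costate_rhs_affine] zk] unfolding costate_rhs_affine .
  also have "\<dots> = (\<integral>\<omega>. vstack (running k \<omega>) 0 \<bullet> z k \<omega> \<partial>M)
      + (\<integral>\<omega>. (transpose (Acal k \<omega>) *v \<mu> \<omega>) \<bullet> z k \<omega> \<partial>M)"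
    unfolding inner_add_left by (rule Bochner_Integration.integral_add[OF int_run int_A])
  also have "(\<integral>\<omega>. vstack (running k \<omega>) 0 \<bullet> z k \<omega> \<partial>M)
      = (\<integral>\<omega>. x k \<omega> \<bullet> (Q k *v y k \<omega>) + (Qbar k *v integral\<^sup>L M (x k)) \<bullet> y k \<omega> \<partial>M)"
    using sym[OF k] by (simp add: z_def inner_vstack inner_add_left inner_symmetric_matrix)
  also have "\<dots> = (\<integral>\<omega>. x k \<omega> \<bullet> (Q k *v y k \<omega>) \<partial>M) + integral\<^sup>L M (x k) \<bullet> (Qbar k *v integral\<^sup>L M (y k))"
    using sym[OF k] Ey xk(2) yk(1)
    by (simp add: square_integrable_inner square_integrable_mult_vec inner_symmetric_matrix
        integrable_mult_vec integral_mult_vec)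
  finally have g_z: "(\<integral>\<omega>. g \<omega> \<bullet> z k \<omega> \<partial>M) = (\<integral>\<omega>. x k \<omega> \<bullet> (Q k *v y k \<omega>) \<partial>M)
      + integral\<^sup>L M (x k) \<bullet> (Qbar k *v integral\<^sup>L M (y k))
      + (\<integral>\<omega>. (transpose (Acal k \<omega>) *v \<mu> \<omega>) \<bullet> z k \<omega> \<partial>M)" .

  have "integral\<^sup>L M (y (Suc k)) = (A k + Abar k) *v integral\<^sup>L M (y k) + (B k + Bbar k) *v integral\<^sup>L M (v k)"
    unfolding y_def by (rule integral_state_Suc[OF k])
      (use yk vk in \<open>auto simp: y_def\<close>)
  then have "z (Suc k) \<omega> = Acal k \<omega> *v z k \<omega> + Bcal k \<omega> *v v k \<omega> + Bmean k \<omega> *v integral\<^sup>L M (v k)" for \<omega>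
    unfolding z_def block_mat_mult_vec vstack_mult_vec
    by (simp add: y_def mf_state.simps(2) Let_def vec_eq_iff split_sum_all matrix_vector_mult_add_rdistrib
        matrix_vector_right_distrib scaleR_add_right flip: scaleR_matrix_vector_assoc)
  then have "\<mu> \<omega> \<bullet> z (Suc k) \<omega> = (transpose (Acal k \<omega>) *v \<mu> \<omega>) \<bullet> z k \<omega>
      + (transpose (Bcal k \<omega>) *v \<mu> \<omega>) \<bullet> v k \<omega>
      + (transpose (Bmean k \<omega>) *v \<mu> \<omega>) \<bullet> integral\<^sup>L M (v k)" for \<omega>
    unfolding inner_transpose_left by (simp add: inner_add_right)
  then have \<mu>_z: "(\<integral>\<omega>. \<mu> \<omega> \<bullet> z (Suc k) \<omega> \<partial>M) = (\<integral>\<omega>. (transpose (Acal k \<omega>) *v \<mu> \<omega>) \<bullet> z k \<omega> \<partial>M)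
      + (\<integral>\<omega>. (transpose (Bcal k \<omega>) *v \<mu> \<omega>) \<bullet> v k \<omega> \<partial>M)
      + (\<integral>\<omega>. transpose (Bmean k \<omega>) *v \<mu> \<omega> \<partial>M) \<bullet> integral\<^sup>L M (v k)"
    using int_A int_B int_Bm by simp

  have "gradient k \<mu> \<omega> \<bullet> v k \<omega> = u k \<omega> \<bullet> (R k *v v k \<omega>) + (Rbar k *v integral\<^sup>L M (u k)) \<bullet> v k \<omega>
      + (transpose (Bcal k \<omega>) *v \<mu> \<omega>) \<bullet> v k \<omega>
      + (\<integral>\<omega>'. transpose (Bmean k \<omega>') *v \<mu> \<omega>' \<partial>M) \<bullet> v k \<omega>" for \<omega>
    using sym[OF k] by (simp add: inner_add_left inner_symmetric_matrix)
  then have "(\<integral>\<omega>. gradient k \<mu> \<omega> \<bullet> v k \<omega> \<partial>M) = (\<integral>\<omega>. u k \<omega> \<bullet> (R k *v v k \<omega>) \<partial>M)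
      + integral\<^sup>L M (u k) \<bullet> (Rbar k *v integral\<^sup>L M (v k))
      + (\<integral>\<omega>. (transpose (Bcal k \<omega>) *v \<mu> \<omega>) \<bullet> v k \<omega> \<partial>M)
      + (\<integral>\<omega>'. transpose (Bmean k \<omega>') *v \<mu> \<omega>' \<partial>M) \<bullet> integral\<^sup>L M (v k)"
    using int_B Ev sym[OF k] uk(3) vk(3)
    by (simp add: square_integrable_inner square_integrable_mult_vec inner_symmetric_matrix
        integrable_mult_vec integral_mult_vec)
  with g_z \<mu>_z show ?thesis by simp
qed

lemma first_variation:
  assumes l: "is_costate l" and v: "mf_admissible M F N v"
  shows "polar x u (state (\<lambda>_. 0) v) v = (\<Sum>k\<le>N. \<integral>\<omega>. gradient k (l (int k)) \<omega> \<bullet> v k \<omega> \<partial>M)"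
proof -
  define y where "y = state (\<lambda>_. 0) v"
  define z where "z = (\<lambda>k \<omega>. vstack (y k \<omega>) (integral\<^sup>L M (y k)))"
  define \<Phi> where "\<Phi> k = (\<integral>\<omega>. l (int k - 1) \<omega> \<bullet> z k \<omega> \<partial>M)" for k
  define q where "q k = (\<integral>\<omega>. x k \<omega> \<bullet> (Q k *v y k \<omega>) \<partial>M)
      + integral\<^sup>L M (x k) \<bullet> (Qbar k *v integral\<^sup>L M (y k))
      + (\<integral>\<omega>. u k \<omega> \<bullet> (R k *v v k \<omega>) \<partial>M)
      + integral\<^sup>L M (u k) \<bullet> (Rbar k *v integral\<^sup>L M (v k))" for k
  define r where "r k = (\<integral>\<omega>. gradient k (l (int k)) \<omega> \<bullet> v k \<omega> \<partial>M)" for k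
  have step: "\<Phi> (Suc k) + q k = \<Phi> k + r k" if "k \<le> N" for k
  proof -
    from costate_duality_step[OF that costate_square_integrable[OF l that] costate_step[OF l that] v]
    show ?thesis by (simp add: \<Phi>_def q_def r_def z_def y_def)
  qed
  have "\<Phi> (Suc n) + (\<Sum>k\<le>n. q k) = \<Phi> 0 + (\<Sum>k\<le>n. r k)" if "n \<le> N" for n
    using that
  proof (induction n)
    case 0
    then show ?case using step[of 0] by simp
  next
    case (Suc n)
    then show ?case using step[of "Suc n"] by simp
  qed
  then have "\<Phi> (Suc N) + (\<Sum>k\<le>N. q k) = \<Phi> 0 + (\<Sum>k\<le>N. r k)" by simp
  moreover have "\<Phi> 0 = 0"
  proof -
    have "z 0 = (\<lambda>_. 0)" by (simp add: z_def y_def fun_eq_iff vec_eq_iff split_sum_all)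
    then show ?thesis by (simp add: \<Phi>_def)
  qed
  moreover have "\<Phi> (Suc N) = (\<integral>\<omega>. x (Suc N) \<omega> \<bullet> (P *v y (Suc N) \<omega>) \<partial>M)
      + integral\<^sup>L M (x (Suc N)) \<bullet> (Pbar *v integral\<^sup>L M (y (Suc N)))"
  proof -
    have yN: "square_integrable M (y (Suc N))"
      using state_variation(2)[OF v] by (simp add: y_def)
    have lN: "square_integrable M (l (int N))" by (rule costate_square_integrable[OF l order_refl])
    have zN: "square_integrable M (z (Suc N))"
      unfolding z_def by (intro square_integrable_vstack yN square_integrable_const)
    have "\<Phi> (Suc N) = (\<integral>\<omega>. x (Suc N) \<omega> \<bullet> (P *v y (Suc N) \<omega>)
        + (Pbar *v integral\<^sup>L M (x (Suc N))) \<bullet> y (Suc N) \<omega> \<partial>M)"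
      unfolding \<Phi>_def
    proof (rule integral_cong_AE)
      have "AE \<omega> in M. l (int N) \<omega> = block_mat P Pbar 0 0 *v vstack (x (Suc N) \<omega>) (integral\<^sup>L M (x (Suc N)))"
        using l by (simp add: mf_costate_def)
      then show "AE \<omega> in M. l (int (Suc N) - 1) \<omega> \<bullet> z (Suc N) \<omega>
          = x (Suc N) \<omega> \<bullet> (P *v y (Suc N) \<omega>) + (Pbar *v integral\<^sup>L M (x (Suc N))) \<bullet> y (Suc N) \<omega>"
        by eventually_elim
          (simp add: block_mat_mult_vec z_def inner_vstack inner_add_left inner_symmetric_matrix[OF sym_terminal(1)])
      show "(\<lambda>\<omega>. l (int (Suc N) - 1) \<omega> \<bullet> z (Suc N) \<omega>) \<in> borel_measurable M"
        using borel_measurable_integrable[OF square_integrable_inner[OF lN zN]] by simp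
      show "(\<lambda>\<omega>. x (Suc N) \<omega> \<bullet> (P *v y (Suc N) \<omega>) + (Pbar *v integral\<^sup>L M (x (Suc N))) \<bullet> y (Suc N) \<omega>)
          \<in> borel_measurable M"
        by (intro borel_measurable_add borel_measurable_integrable square_integrable_inner
            square_integrable_mult_vec yN state_u square_integrable_const order_refl)
    qed
    also have "\<dots> = (\<integral>\<omega>. x (Suc N) \<omega> \<bullet> (P *v y (Suc N) \<omega>) \<partial>M)
        + (\<integral>\<omega>. (Pbar *v integral\<^sup>L M (x (Suc N))) \<bullet> y (Suc N) \<omega> \<partial>M)"
      by (intro Bochner_Integration.integral_add square_integrable_inner
          square_integrable_mult_vec yN state_u square_integrable_const order_refl)
    also have "(\<integral>\<omega>. (Pbar *v integral\<^sup>L M (x (Suc N))) \<bullet> y (Suc N) \<omega> \<partial>M)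
        = integral\<^sup>L M (x (Suc N)) \<bullet> (Pbar *v integral\<^sup>L M (y (Suc N)))"
      using integral_inner_right[of "Pbar *v integral\<^sup>L M (x (Suc N))" M "y (Suc N)"]
        square_integrable_integrable[OF yN] inner_symmetric_matrix[OF sym_terminal(2)] by metis
    finally show ?thesis .
  qed
  ultimately show ?thesis
    by (simp add: mf_bilinear_def q_def r_def flip: y_def)
qed

lemma polar_zero_if_optimal:
  assumes optimal: "\<And>v. mf_admissible M F N v \<Longrightarrow>
      mf_cost M N Q Qbar R Rbar P Pbar x u \<le> mf_cost M N Q Qbar R Rbar P Pbar (state \<xi> v) v"
    and v: "mf_admissible M F N v"
  shows "polar x u (state (\<lambda>_. 0) v) v = 0"
proof (rule nonneg_perturbation_linear_zero)
  fix t :: real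
  let ?u = "\<lambda>k \<omega>. u k \<omega> + t *\<^sub>R v k \<omega>"
  have adm: "mf_admissible M F N ?u"
    unfolding mf_admissible_def
  proof (intro allI impI conjI)
    fix k assume k: "k \<le> N"
    note uv = admissibleD[OF admissible k] admissibleD[OF v k]
    show "?u k \<in> borel_measurable (F (int k - 1))"
      using uv by (intro borel_measurable_add borel_measurable_scaleR borel_measurable_const)
    have "square_integrable M (?u k)"
      using uv by (intro square_integrable_add square_integrable_scaleR)
    then show "integrable M (\<lambda>\<omega>. (norm (?u k \<omega>))\<^sup>2)"
      by (simp add: square_integrable_def)
  qed
  have x': "state \<xi> ?u k = (\<lambda>\<omega>. x k \<omega> + t *\<^sub>R state (\<lambda>_. 0) v k \<omega>)" if "k \<le> Suc N" for k
    by (rule state_perturb[OF measurable_init_past init_square_integrable _ _ _ _ that])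
      (use admissibleD[OF admissible] admissibleD[OF v] in auto)
  have cost: "mf_cost M N Q Qbar R Rbar P Pbar (state \<xi> v) v = polar (state \<xi> v) v (state \<xi> v) v"
    if "mf_admissible M F N v" for v
    by (intro mf_cost_eq_bilinear state_admissible[OF measurable_init_past init_square_integrable that]
        admissibleD[OF that])
  have "polar (state \<xi> ?u) ?u (state \<xi> ?u) ?u = polar x u x u
      + 2 * t * polar x u (state (\<lambda>_. 0) v) v
      + t\<^sup>2 * polar (state (\<lambda>_. 0) v) v (state (\<lambda>_. 0) v) v"
    using x' by (intro mf_bilinear_perturb state_u state_variation[OF v] admissibleD[OF admissible]
        admissibleD[OF v] sym sym_terminal) auto
  then show "0 \<le> 2 * t * polar x u (state (\<lambda>_. 0) v) v
      + t\<^sup>2 * polar (state (\<lambda>_. 0) v) v (state (\<lambda>_. 0) v) v"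
    using optimal[OF adm] cost[OF adm] cost[OF admissible] by linarith
qed

lemma gradient_cond_exp_zero:
  assumes optimal: "\<And>v. mf_admissible M F N v \<Longrightarrow>
      mf_cost M N Q Qbar R Rbar P Pbar x u \<le> mf_cost M N Q Qbar R Rbar P Pbar (state \<xi> v) v"
    and l: "is_costate l" and k: "k \<le> N"
  shows "is_cond_exp M (F (int k - 1)) (gradient k (l (int k))) (\<lambda>_. 0)"
proof -
  interpret white_step_conditional M "H k" "w k" "\<sigma>\<^sup>2" "F (int k - 1)" by (rule step[OF k])
  show ?thesis
  proof (rule is_cond_exp_zeroI)
    show "integrable M (gradient k (l (int k)))"
      by (rule gradient_integrable[OF k costate_square_integrable[OF l k]])
    fix S i assume S: "S \<in> sets (F (int k - 1))"
    define h :: "'a \<Rightarrow> real ^ 'm" where "h = (\<lambda>\<omega>. indicator S \<omega> *\<^sub>R axis i 1)"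
    define v where "v = (\<lambda>j. if j = k then h else (\<lambda>_. 0))"
    have h: "h \<in> borel_measurable (F (int k - 1))"
      unfolding h_def using S by (intro borel_measurable_scaleR borel_measurable_indicator borel_measurable_const)
    have "square_integrable M h"
      by (rule square_integrable_bound[OF square_integrable_const[of "1::real"], where K = 1])
        (use measurable_GM[OF h] in \<open>auto simp: h_def norm_axis_1 indicator_def\<close>)
    then have v: "mf_admissible M F N v"
      using h by (simp add: mf_admissible_def v_def square_integrable_def)
    have "(\<Sum>j\<le>N. \<integral>\<omega>. gradient j (l (int j)) \<omega> \<bullet> v j \<omega> \<partial>M) = 0"
      using first_variation[OF l v] polar_zero_if_optimal[OF optimal v] by simp
    moreover have "(\<Sum>j\<le>N. \<integral>\<omega>. gradient j (l (int j)) \<omega> \<bullet> v j \<omega> \<partial>M)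
        = (\<Sum>j\<le>N. if j = k then \<integral>\<omega>. gradient k (l (int k)) \<omega> \<bullet> h \<omega> \<partial>M else 0)"
      by (rule sum.cong) (auto simp: v_def)
    ultimately show "(\<integral>\<omega>. gradient k (l (int k)) \<omega> \<bullet> (indicator S \<omega> *\<^sub>R axis i 1) \<partial>M) = 0"
      using k by (simp add: h_def)
  qed
qed

end

theorem lemma2:
  fixes M :: "'a measure" and N :: nat and \<sigma> :: real
    and w :: "nat \<Rightarrow> 'a \<Rightarrow> real" and \<xi> :: "'a \<Rightarrow> real ^ 'n"
    and A Abar C Cbar :: "nat \<Rightarrow> real ^ 'n ^ 'n"
    and B Bbar D Dbar :: "nat \<Rightarrow> real ^ 'm ^ 'n"
    and Q Qbar :: "nat \<Rightarrow> real ^ 'n ^ 'n"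
    and R Rbar :: "nat \<Rightarrow> real ^ 'm ^ 'm"
    and P Pbar :: "real ^ 'n ^ 'n"
    and u :: "nat \<Rightarrow> 'a \<Rightarrow> real ^ 'm"
    and F :: "int \<Rightarrow> 'a measure"
    and x :: "(nat \<Rightarrow> 'a \<Rightarrow> real ^ 'm) \<Rightarrow> nat \<Rightarrow> 'a \<Rightarrow> real ^ 'n"
  assumes prob: "prob_space M"
    and noise: "white_noise M N \<sigma> w"
    and init_meas: "\<xi> \<in> borel_measurable M"
    and init_L2: "integrable M (\<lambda>\<omega>. (norm (\<xi> \<omega>))\<^sup>2)"
    and init_indep: "prob_space.indep_set M
          (sets (vimage_algebra (space M) \<xi> borel))
          (sets (vimage_algebra (space M) (\<lambda>\<omega>. \<lambda>k\<in>{..N}. w k \<omega>) (PiM {..N} (\<lambda>_. borel))))"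
    and sym: "\<And>k. k \<le> N \<Longrightarrow> transpose (Q k) = Q k \<and> transpose (Qbar k) = Qbar k \<and>
                transpose (R k) = R k \<and> transpose (Rbar k) = Rbar k"
    and sym_terminal: "transpose P = P" "transpose Pbar = Pbar"
    and F_eq: "F = mf_filtration M \<xi> w"
    and x_eq: "x = mf_state M A Abar B Bbar C Cbar D Dbar w \<xi>"
    and admissible: "mf_admissible M F N u"
    and optimal: "\<And>v. mf_admissible M F N v \<Longrightarrow>
          mf_cost M N Q Qbar R Rbar P Pbar (x u) u \<le> mf_cost M N Q Qbar R Rbar P Pbar (x v) v"
  shows "(\<exists>l. mf_costate M F N A Abar C Cbar Q Qbar P Pbar w (x u) l) \<and>
    (\<forall>l. mf_costate M F N A Abar C Cbar Q Qbar P Pbar w (x u) l \<longrightarrow>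
      (\<forall>k\<le>N.
        integrable M (\<lambda>\<omega>. transpose (vstack (Bbar k + w k \<omega> *\<^sub>R Dbar k) (B k + Bbar k)) *v l (int k) \<omega>) \<and>
        is_cond_exp M (F (int k - 1))
          (\<lambda>\<omega>. R k *v u k \<omega> + Rbar k *v integral\<^sup>L M (u k)
             + transpose (vstack (B k + w k \<omega> *\<^sub>R D k) 0) *v l (int k) \<omega>
             + (\<integral>\<omega>'. transpose (vstack (Bbar k + w k \<omega>' *\<^sub>R Dbar k) (B k + Bbar k)) *v l (int k) \<omega>' \<partial>M))
          (\<lambda>\<omega>. 0)))"
proof -
  interpret mf_noise M N \<sigma> w \<xi>
    unfolding mf_noise_def mf_noise_axioms_def using prob noise init_meas init_L2 init_indep by blast
  interpret mf_control M N \<sigma> w \<xi> A Abar C Cbar B Bbar D Dbar Q Qbar R Rbar P Pbar u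
    by unfold_locales (use sym sym_terminal admissible F_eq in auto)
  show ?thesis
    unfolding F_eq x_eq
    using costate_exists costate_square_integrable gradient_integrable(1)
      gradient_cond_exp_zero[OF optimal[unfolded F_eq x_eq]]
    by blast
qed

end
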